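(* Let $A$ be a unital separable C*-algebra, $G$ a second-countable compact group, and $\alpha\colon G\to\mathrm{Aut}(A)$ an action with the Rokhlin property. Then the inclusion $\iota\colon A^\alpha\to A$ induces an order-embedding $\mathrm{Cu}(\iota)\colon\mathrm{Cu}(A^\alpha)\to\mathrm{Cu}(A)$; that is, whenever $x,y\in\mathrm{Cu}(A^\alpha)$ satisfy $\mathrm{Cu}(\iota)(x)\le\mathrm{Cu}(\iota)(y)$, then $x\le y$.
   Context: For positive $a,b$ in a C*-algebra $D$, $a\precsim b$ (Cuntz subequivalence) if there are $x_n\in D$ with $\|x_n^*bx_n-a\|\to0$; $a\sim b$ if $a\precsim b$ and $b\precsim a$. $\mathrm{Cu}(D)$ is the set of $\sim$-classes of positive elements of $D\otimes\mathcal K$, with addition by direct sum and order $[a]\le[b]$ iff $a\precsim b$; a homomorphism $\varphi$ induces $\mathrm{Cu}(\varphi)([a])=[(\varphi\otimes\mathrm{id}_{\mathcal K})(a)]$. Rokhlin property: with $A_\infty=\ell^\infty(\mathbb N,A)/c_0(\mathbb N,A)$ (quotient map $\kappa_A$, $A$ as constant sequences), $\alpha^\infty$ coordinatewise, $\ell^\infty_\alpha(\mathbb N,A)$ the sequences $a$ with $g\mapsto\alpha^\infty_g(a)$ norm continuous, $A_{\infty,\alpha}=\kappa_A(\ell^\infty_\alpha(\mathbb N,A))$ with action $\alpha_\infty$, $\mathtt{Lt}_g(f)(h)=f(g^{-1}h)$: there is a unital homomorphism $\varphi\colon C(G)\to A_{\infty,\alpha}\cap A'$ with $\varphi\circ\mathtt{Lt}_g=(\alpha_\infty)_g\circ\varphi$.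 *)

theory Defs
  imports "HOL-Analysis.Analysis"
begin

class cstar_algebra = real_normed_algebra_1 + banach +
  fixes cscale :: "complex \<Rightarrow> 'a \<Rightarrow> 'a"
    and adj :: "'a \<Rightarrow> 'a"
  assumes cscale_add_right: "cscale c (x + y) = cscale c x + cscale c y"
    and cscale_add_left: "cscale (c + d) x = cscale c x + cscale d x"
    and cscale_cscale: "cscale c (cscale d x) = cscale (c * d) x"
    and cscale_of_real: "cscale (of_real r) x = scaleR r x"
    and cscale_mult_left: "cscale c x * y = cscale c (x * y)"
    and cscale_mult_right: "x * cscale c y = cscale c (x * y)"
    and norm_cscale: "norm (cscale c x) = cmod c * norm x"
    and adj_adj: "adj (adj x) = x"
    and adj_add: "adj (x + y) = adj x + adj y"
    and adj_cscale: "adj (cscale c x) = cscale (cnj c) (adj x)"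
    and adj_mult: "adj (x * y) = adj y * adj x"
    and cstar_identity: "norm (adj x * x) = norm x * norm x"

definition separable_type :: "'a::topological_space itself \<Rightarrow> bool" where
  "separable_type _ \<longleftrightarrow> (\<exists>D::'a set. countable D \<and> closure D = UNIV)"

definition cstar_aut :: "('a::cstar_algebra \<Rightarrow> 'a) \<Rightarrow> bool" where
  "cstar_aut h \<longleftrightarrow> bij h \<and> (\<forall>x y. h (x + y) = h x + h y)
     \<and> (\<forall>c x. h (cscale c x) = cscale c (h x))
     \<and> (\<forall>x y. h (x * y) = h x * h y) \<and> (\<forall>x. h (adj x) = adj (h x))"

text \<open>Compact (Hausdorff) topological group, written additively (group_add need not
  be commutative), and a point-norm continuous action by *-automorphisms.\<close>

definition compact_group :: "'g::{t2_space,group_add} itself \<Rightarrow> bool" where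
  "compact_group _ \<longleftrightarrow> compact (UNIV::'g set)
     \<and> continuous_on UNIV (\<lambda>p::'g \<times> 'g. fst p + snd p)
     \<and> continuous_on UNIV (\<lambda>x::'g. - x)"

definition cstar_action :: "('g::{topological_space,group_add} \<Rightarrow> 'a::cstar_algebra \<Rightarrow> 'a) \<Rightarrow> bool" where
  "cstar_action \<alpha> \<longleftrightarrow> (\<forall>g. cstar_aut (\<alpha> g)) \<and> \<alpha> 0 = id
     \<and> (\<forall>g h. \<alpha> (g + h) = \<alpha> g \<circ> \<alpha> h)
     \<and> (\<forall>a. continuous_on UNIV (\<lambda>g. \<alpha> g a))"

definition fixed_points :: "('g \<Rightarrow> 'a \<Rightarrow> 'a) \<Rightarrow> 'a set" where
  "fixed_points \<alpha> = {a. \<forall>g. \<alpha> g a = a}"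

text \<open>For a C*-subalgebra B of A, B \<otimes> K is realised as the set of infinite matrices
  with entries in B whose upper-left n x n truncations form a Cauchy sequence for the
  C*-norms of M_n(A).  The norm on M_n(A) is the operator norm on the Hilbert
  A-module A^n.\<close>

type_synonym 'a mat = "nat \<Rightarrow> nat \<Rightarrow> 'a"

definition trunc :: "nat \<Rightarrow> 'a::zero mat \<Rightarrow> 'a mat" where
  "trunc n x = (\<lambda>i j. if i < n \<and> j < n then x i j else 0)"

definition mnorm_n :: "nat \<Rightarrow> 'a::cstar_algebra mat \<Rightarrow> real" where
  "mnorm_n n x = Sup {sqrt (norm (\<Sum>i<n. adj (\<Sum>j<n. x i j * \<xi> j) * (\<Sum>j<n. x i j * \<xi> j)))
      | \<xi>. norm (\<Sum>j<n. adj (\<xi> j) * \<xi> j) \<le> 1}"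

definition mnorm :: "'a::cstar_algebra mat \<Rightarrow> real" where
  "mnorm x = (SUP n. mnorm_n n x)"

definition stab :: "'a::cstar_algebra set \<Rightarrow> 'a mat set" where
  "stab B = {x. (\<forall>i j. x i j \<in> B) \<and>
     (\<forall>e>0. \<exists>N. \<forall>m\<ge>N. \<forall>n\<ge>m. mnorm_n n (\<lambda>i j. x i j - trunc m x i j) < e)}"

definition mmult :: "'a::cstar_algebra mat \<Rightarrow> 'a mat \<Rightarrow> 'a mat" where
  "mmult x y = (\<lambda>i j. lim (\<lambda>n. \<Sum>k<n. x i k * y k j))"

definition madj :: "'a::cstar_algebra mat \<Rightarrow> 'a mat" where
  "madj x = (\<lambda>i j. adj (x j i))"

definition cu_pos :: "'a::cstar_algebra set \<Rightarrow> 'a mat set" where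
  "cu_pos B = {a. \<exists>c \<in> stab B. a = mmult (madj c) c}"

definition cuntz_le :: "'a::cstar_algebra set \<Rightarrow> 'a mat \<Rightarrow> 'a mat \<Rightarrow> bool" where
  "cuntz_le B a b \<longleftrightarrow> (\<exists>v. (\<forall>k. v k \<in> stab B) \<and>
     (\<lambda>k. mnorm (\<lambda>i j. mmult (mmult (madj (v k)) b) (v k) i j - a i j)) \<longlonglongrightarrow> 0)"

text \<open>A unital *-homomorphism C(G) \<rightarrow> A_{\<infinity>,\<alpha>} \<inter> A' is given by choosing, for every
  continuous f, a bounded representing sequence \<phi> f lying in ell-infinity-alpha(\<nat>,A); all
  algebraic identities hold modulo c_0.  Lt_g f = (\<lambda>h. f (-g + h)).\<close>

definition rokhlin :: "('g::{topological_space,group_add} \<Rightarrow> 'a::cstar_algebra \<Rightarrow> 'a) \<Rightarrow> bool" where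
  "rokhlin \<alpha> \<longleftrightarrow> (\<exists>\<phi> :: ('g \<Rightarrow> complex) \<Rightarrow> nat \<Rightarrow> 'a.
     (\<forall>f. continuous_on UNIV f \<longrightarrow>
        bounded (range (\<phi> f))
        \<and> (\<forall>g0. \<forall>e>0. eventually (\<lambda>g. \<forall>n. norm (\<alpha> g (\<phi> f n) - \<alpha> g0 (\<phi> f n)) \<le> e) (nhds g0))
        \<and> (\<forall>a. (\<lambda>n. \<phi> f n * a - a * \<phi> f n) \<longlonglongrightarrow> 0)
        \<and> (\<forall>g. (\<lambda>n. \<phi> (\<lambda>h. f (- g + h)) n - \<alpha> g (\<phi> f n)) \<longlonglongrightarrow> 0)
        \<and> (\<lambda>n. \<phi> (\<lambda>h. cnj (f h)) n - adj (\<phi> f n)) \<longlonglongrightarrow> 0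
        \<and> (\<forall>c. (\<lambda>n. \<phi> (\<lambda>h. c * f h) n - cscale c (\<phi> f n)) \<longlonglongrightarrow> 0))
     \<and> (\<forall>f f'. continuous_on UNIV f \<and> continuous_on UNIV f' \<longrightarrow>
        (\<lambda>n. \<phi> (\<lambda>h. f h + f' h) n - (\<phi> f n + \<phi> f' n)) \<longlonglongrightarrow> 0
        \<and> (\<lambda>n. \<phi> (\<lambda>h. f h * f' h) n - \<phi> f n * \<phi> f' n) \<longlonglongrightarrow> 0)
     \<and> (\<lambda>n. \<phi> (\<lambda>h. 1) n - 1) \<longlonglongrightarrow> 0)"

end

theory Submission
  imports Defs
begin

text \<open>Choose \<open>v\<close> over \<open>A\<close> with \<open>v\<^sup>* b v\<close> close to \<open>a\<close>; cutting down, \<open>v\<close> is an \<open>N \<times> N\<close> matrix.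
  Take a fine partition of unity \<open>p\<^sub>g\<close> on \<open>G\<close> centred at finitely many \<open>g\<close> and let
  \<open>w\<^sub>n = \<Sum>\<^sub>g \<phi>(p\<^sub>g)\<^sub>n \<alpha>\<^sub>g(v)\<close>. Since \<open>\<phi>\<close> is asymptotically central and multiplicative, \<open>w\<^sub>n\<^sup>* b w\<^sub>n - a\<close> is
  asymptotically \<open>\<Sum> \<phi>(p\<^sub>s p\<^sub>t)\<^sub>n (\<alpha>\<^sub>s(v)\<^sup>* b \<alpha>\<^sub>t(v) - a)\<close>, where only terms with \<open>\<alpha>\<^sub>s(v)\<close> near \<open>\<alpha>\<^sub>t(v)\<close> matter;
  these are near \<open>\<alpha>\<^sub>s(v\<^sup>* b v - a)\<close>, and the sum is no larger than its largest coefficient. By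
  equivariance \<open>w\<^sub>n\<close> is almost invariant. Gluing the translates of an almost invariant matrix in the
  same way gives matrices close to it that are as invariant as desired; iterating, one reaches a
  matrix over the fixed point algebra, so no Haar integral is required. The norm estimates rest on
  positivity in C*-algebras: square roots come from the binomial series, and \<open>x\<^sup>* x\<close> is positive
  because \<open>y y\<^sup>* \<ge> 0\<close> implies \<open>y\<^sup>* y \<ge> 0\<close>.\<close>

section \<open>The binomial series in a Banach algebra\<close>

definition binom_series :: "real \<Rightarrow> 'a::{real_normed_algebra_1,banach} \<Rightarrow> 'a" where
  "binom_series a y = (\<Sum>n. (a gchoose n) *\<^sub>R y ^ n)"

abbreviation binom_summable :: "real \<Rightarrow> 'a::{real_normed_algebra_1,banach} \<Rightarrow> bool" where
  "binom_summable a y \<equiv> summable (\<lambda>n. norm ((a gchoose n) *\<^sub>R y ^ n))"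

lemma abs_gbinomial_nonpos:
  fixes a :: real
  assumes "a \<le> 0"
  shows "\<bar>a gchoose n\<bar> = (-1) ^ n * (a gchoose n)"
proof -
  have "0 \<le> pochhammer (- a) n" using assms by (simp add: pochhammer_prod prod_nonneg)
  then show ?thesis by (simp add: gbinomial_pochhammer abs_mult)
qed

lemma abs_gbinomial_Suc:
  fixes a :: real
  assumes "0 \<le> a" "a \<le> 1"
  shows "\<bar>a gchoose Suc n\<bar> = (-1) ^ n * (a gchoose Suc n)"
proof -
  have "a gchoose Suc n = a / real (Suc n) * (a - 1 gchoose n)"
    using gbinomial_absorption'[of "Suc n" a] by simp
  moreover have "\<bar>a - 1 gchoose n\<bar> = (-1) ^ n * (a - 1 gchoose n)"
    using assms(2) by (intro abs_gbinomial_nonpos) simp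
  ultimately show ?thesis using assms(1) by (simp add: abs_mult)
qed

lemma sum_abs_gbinomial_Suc_le:
  fixes a :: real
  assumes "0 \<le> a" "a \<le> 1"
  shows "(\<Sum>k<n. \<bar>a gchoose Suc k\<bar>) \<le> 1"
proof -
  have "0 \<le> \<bar>a - 1 gchoose n\<bar>" by simp
  also have "\<dots> = (\<Sum>k\<le>n. (a gchoose k) * (-1) ^ k)"
    using assms(2) by (simp add: abs_gbinomial_nonpos gbinomial_sum_lower_neg)
  also have "\<dots> = 1 - (\<Sum>k<n. \<bar>a gchoose Suc k\<bar>)"
    by (simp add: sum.atMost_shift abs_gbinomial_Suc[OF assms] sum_negf mult.commute)
  finally show ?thesis by simp
qed

lemma
  fixes y :: "'a::{real_normed_algebra_1,banach}"
  assumes exponent: "0 \<le> a" "a \<le> 1" and norm_y: "norm y \<le> 1"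
  shows summable_binom_series: "binom_summable a y"
    and norm_binom_series_diff_1_le: "norm (binom_series a y - 1) \<le> 1"
proof -
  let ?f = "\<lambda>n. (a gchoose n) *\<^sub>R y ^ n"
  have term_le: "norm (?f n) \<le> \<bar>a gchoose n\<bar>" for n
  proof -
    have "norm (y ^ n) \<le> 1"
      using norm_power_ineq[of y n] power_le_one[of "norm y" n] norm_y by simp
    then show ?thesis by (simp add: mult_left_le)
  qed
  have partial_le: "(\<Sum>k<n. norm (?f (Suc k))) \<le> 1" for n
    by (rule order_trans[OF sum_mono[OF term_le] sum_abs_gbinomial_Suc_le[OF exponent]])
  have summable_Suc: "summable (\<lambda>n. norm (?f (Suc n)))"
    by (rule summableI_nonneg_bounded[of _ 1]) (use partial_le in auto)
  then show summable: "binom_summable a y" by (subst (asm) summable_Suc_iff)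
  have "binom_series a y - 1 = (\<Sum>n. ?f (Suc n))"
    unfolding binom_series_def using suminf_split_head[OF summable_norm_cancel[OF summable]] by simp
  also have "norm \<dots> \<le> (\<Sum>n. norm (?f (Suc n)))" by (rule summable_norm[OF summable_Suc])
  also have "\<dots> \<le> 1" by (rule suminf_le_const[OF summable_Suc partial_le])
  finally show "norm (binom_series a y - 1) \<le> 1" .
qed

lemma binom_series_mult:
  assumes "binom_summable a y" "binom_summable b y"
  shows "binom_series a y * binom_series b y = binom_series (a + b) y"
proof -
  have "(\<Sum>i\<le>k. ((a gchoose i) *\<^sub>R y ^ i) * ((b gchoose (k - i)) *\<^sub>R y ^ (k - i)))
      = ((a + b) gchoose k) *\<^sub>R y ^ k" for k
  proof -
    have "((a gchoose i) *\<^sub>R y ^ i) * ((b gchoose (k - i)) *\<^sub>R y ^ (k - i))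
        = ((a gchoose i) * (b gchoose (k - i))) *\<^sub>R y ^ k" if "i \<le> k" for i
      using that by (simp add: power_add[symmetric] mult.commute)
    then show ?thesis
      by (simp add: scaleR_sum_left[symmetric] gbinomial_Vandermonde atMost_atLeast0)
  qed
  then show ?thesis
    unfolding binom_series_def using Cauchy_product[OF assms] by simp
qed

lemma binom_series_1: "binom_series 1 y = 1 + y"
proof -
  have "((1::real) gchoose n) *\<^sub>R y ^ n = 0" if "n \<notin> {..1}" for n
    using that binomial_gbinomial[of 1 n, where ?'a = real] by (simp add: binomial_eq_0)
  then have "binom_series 1 y = (\<Sum>n\<le>1. ((1::real) gchoose n) *\<^sub>R y ^ n)"
    unfolding binom_series_def by (intro suminf_finite) auto
  then show ?thesis by simp
qed

lemma binom_series_commute: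
  assumes "binom_summable a y" "z * y = y * z"
  shows "z * binom_series a y = binom_series a y * z"
proof -
  have summable: "summable (\<lambda>n. (a gchoose n) *\<^sub>R y ^ n)"
    by (rule summable_norm_cancel[OF assms(1)])
  have "z * y ^ n = y ^ n * z" for n
    by (rule power_commuting_commutes[symmetric]) (simp add: assms(2))
  then show ?thesis
    unfolding binom_series_def suminf_mult[OF summable, symmetric] suminf_mult2[OF summable] by simp
qed

section \<open>Positive elements of a C*-algebra\<close>

declare adj_adj [simp]

lemma adj_0 [simp]: "adj (0::'a::cstar_algebra) = 0"
  using adj_add[of "0::'a" 0] by simp

lemma adj_minus [simp]: "adj (- x) = - adj (x::'a::cstar_algebra)"
  using adj_add[of x "- x"] by (simp add: eq_neg_iff_add_eq_0 add.commute)

lemma adj_diff: "adj (x - y) = adj x - adj (y::'a::cstar_algebra)"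
  using adj_add[of x "- y"] by simp

lemma adj_1 [simp]: "adj (1::'a::cstar_algebra) = 1"
  by (metis adj_adj adj_mult mult.left_neutral mult.right_neutral)

lemma adj_scaleR: "adj (r *\<^sub>R x) = r *\<^sub>R adj (x::'a::cstar_algebra)"
  by (metis adj_cscale complex_cnj_complex_of_real cscale_of_real)

lemma adj_sum: "adj (sum f S) = (\<Sum>i\<in>S. adj (f i :: 'a::cstar_algebra))"
  by (induction S rule: infinite_finite_induct) (auto simp: adj_add)

lemma adj_power: "adj (x ^ n) = adj (x::'a::cstar_algebra) ^ n"
  by (induction n) (auto simp: adj_mult power_commutes)

lemma norm_adj_mult_self: "norm (adj x * x) = (norm (x::'a::cstar_algebra))\<^sup>2"
  by (simp add: cstar_identity power2_eq_square)

lemma norm_adj [simp]: "norm (adj x) = norm (x::'a::cstar_algebra)"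
proof -
  have norm_le: "norm y \<le> norm (adj y)" for y :: 'a
  proof (cases "y = 0")
    case False
    have "norm y * norm y \<le> norm (adj y) * norm y"
      using norm_mult_ineq[of "adj y" y] by (simp add: cstar_identity)
    then show ?thesis using False by simp
  qed simp
  show ?thesis using norm_le[of x] norm_le[of "adj x"] by simp
qed

lemma bounded_linear_adj: "bounded_linear (adj :: 'a::cstar_algebra \<Rightarrow> 'a)"
  by (rule bounded_linear_intro[where K=1]) (auto simp: adj_add adj_scaleR)

lemma norm_self_adjoint_square:
  "adj h = h \<Longrightarrow> norm (h * h) = (norm (h::'a::cstar_algebra))\<^sup>2"
  using norm_adj_mult_self[of h] by simp

lemma norm_self_adjoint_power2:
  fixes h :: "'a::cstar_algebra"
  assumes "adj h = h"
  shows "norm (h ^ 2 ^ k) = norm h ^ 2 ^ k"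
proof (induction k)
  case (Suc k)
  have "h ^ 2 ^ Suc k = h ^ 2 ^ k * h ^ 2 ^ k" by (simp add: mult_2 power_add)
  then have "norm (h ^ 2 ^ Suc k) = (norm (h ^ 2 ^ k))\<^sup>2"
    by (simp add: norm_self_adjoint_square adj_power assms)
  then show ?case by (simp add: Suc power_mult[symmetric] mult.commute)
qed simp

lemma cscale_minus_one: "cscale (- 1) x = - (x::'a::cstar_algebra)"
  using cscale_of_real[of "-1" x] by simp

lemma cscale_minus_left: "cscale (- c) x = - cscale c (x::'a::cstar_algebra)"
  by (metis cscale_cscale cscale_minus_one mult_minus1)

lemma cscale_minus_right: "cscale c (- x) = - cscale c (x::'a::cstar_algebra)"
  by (metis cscale_cscale cscale_minus_left cscale_minus_one mult.commute mult_minus1)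

lemma cscale_zero_left [simp]: "cscale 0 x = (0::'a::cstar_algebra)"
  using cscale_of_real[of 0 x] by simp

lemma cscale_diff_right: "cscale c (x - y) = cscale c x - cscale c (y::'a::cstar_algebra)"
  by (metis add_uminus_conv_diff cscale_add_right cscale_minus_right)

abbreviation i_times :: "'a::cstar_algebra \<Rightarrow> 'a" where "i_times x \<equiv> cscale \<i> x"

lemma i_times_i_times: "i_times (i_times x) = - (x::'a::cstar_algebra)"
  by (simp add: cscale_cscale cscale_minus_one)

lemma adj_i_times: "adj (i_times x) = - i_times (adj (x::'a::cstar_algebra))"
  by (simp add: adj_cscale cscale_minus_left)

lemma adj_binom_series:
  assumes "binom_summable a (y::'a::cstar_algebra)" "adj y = y"
  shows "adj (binom_series a y) = binom_series a y"
  unfolding binom_series_def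
  by (subst bounded_linear.suminf[OF bounded_linear_adj summable_norm_cancel[OF assms(1)]])
     (simp add: adj_scaleR adj_power assms(2))

definition psd :: "'a::cstar_algebra \<Rightarrow> bool" where
  "psd x \<longleftrightarrow> (\<exists>k. adj k = k \<and> x = k * k)"

abbreviation psd_le :: "'a::cstar_algebra \<Rightarrow> 'a \<Rightarrow> bool" (infix "\<preceq>" 50) where
  "x \<preceq> y \<equiv> psd (y - x)"

lemma sqrt_exists:
  fixes x :: "'a::cstar_algebra"
  assumes self_adjoint: "adj x = x" and norm_t: "norm (t *\<^sub>R 1 - x) \<le> t"
  obtains k where "adj k = k" "k * k = x"
    "norm (sqrt t *\<^sub>R 1 - k) \<le> sqrt t" "\<And>z. z * x = x * z \<Longrightarrow> z * k = k * z"
proof (cases "t = 0")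
  case True
  then show ?thesis using norm_t that[of 0] by simp
next
  case False
  then have t_pos: "t > 0" using norm_t norm_ge_zero order_trans less_le by metis
  define y where "y = inverse t *\<^sub>R x - 1"
  have "y = - (inverse t *\<^sub>R (t *\<^sub>R 1 - x))"
    unfolding y_def using t_pos by (simp add: scaleR_right_diff_distrib)
  then have y_le: "norm y \<le> 1" using norm_t t_pos by (simp add: divide_le_eq_1 inverse_eq_divide)
  have y_adj: "adj y = y" by (simp add: y_def adj_diff adj_scaleR self_adjoint)
  have summable: "binom_summable (1/2) y" by (rule summable_binom_series[OF _ _ y_le]) auto
  define k where "k = sqrt t *\<^sub>R binom_series (1/2) y"
  show ?thesis
  proof (rule that)
    have "k * k = t *\<^sub>R (1 + y)"
      unfolding k_def using binom_series_mult[OF summable summable] t_pos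
      by (simp add: binom_series_1)
    then show "k * k = x" unfolding y_def using t_pos by simp
    show "adj k = k" unfolding k_def by (simp add: adj_scaleR adj_binom_series[OF summable y_adj])
    have "sqrt t *\<^sub>R 1 - k = - (sqrt t *\<^sub>R (binom_series (1/2) y - 1))"
      by (simp add: k_def scaleR_right_diff_distrib)
    then show "norm (sqrt t *\<^sub>R 1 - k) \<le> sqrt t"
      using norm_binom_series_diff_1_le[of "1/2" y] y_le t_pos by (simp add: mult_left_le)
    show "z * k = k * z" if "z * x = x * z" for z
    proof -
      have "z * y = y * z" unfolding y_def using that by (simp add: algebra_simps)
      then show ?thesis unfolding k_def using binom_series_commute[OF summable] by simp
    qed
  qed
qed

text \<open>For \<open>u = k + \<i> m\<close> one has \<open>u\<^sup>* u = k\<^sup>2 + m\<^sup>2\<close> and \<open>k = (u + u\<^sup>*) / 2\<close>.\<close>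
lemma norm_le_of_sum_squares:
  fixes k m :: "'a::cstar_algebra"
  assumes adj_k: "adj k = k" and adj_m: "adj m = m" and commute: "k * m = m * k"
    and sum: "k * k + m * m = t *\<^sub>R 1" and t_nonneg: "t \<ge> 0"
  shows "norm (k * k) \<le> t"
proof -
  define u where "u = k + i_times m"
  have adj_u: "adj u = k - i_times m" by (simp add: u_def adj_add adj_i_times adj_k adj_m)
  have "adj u * u = k * k + m * m"
    unfolding adj_u unfolding u_def
    by (simp add: algebra_simps cscale_mult_left cscale_mult_right cscale_diff_right commute
        i_times_i_times)
  then have norm_u: "(norm u)\<^sup>2 = t" using sum t_nonneg norm_adj_mult_self[of u] by simp
  have "2 *\<^sub>R k = u + adj u" by (simp add: adj_u) (simp add: u_def scaleR_2)
  then have "2 * norm k \<le> norm u + norm u"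
    by (metis norm_adj norm_scaleR norm_triangle_ineq abs_numeral)
  then have "(norm k)\<^sup>2 \<le> (norm u)\<^sup>2" by (simp add: power_mono)
  then show ?thesis by (simp add: norm_u norm_self_adjoint_square adj_k)
qed

lemma psd_self_adjoint: "psd x \<Longrightarrow> adj x = (x::'a::cstar_algebra)"
  by (auto simp: psd_def adj_mult)

lemma psd_square: "adj k = k \<Longrightarrow> psd (k * (k::'a::cstar_algebra))"
  by (auto simp: psd_def)

lemma psd_of_norm: "adj x = x \<Longrightarrow> norm (t *\<^sub>R 1 - x) \<le> t \<Longrightarrow> psd (x::'a::cstar_algebra)"
  by (metis sqrt_exists psd_def)

lemma norm_scalar_diff_psd_le:
  assumes "psd x" "norm (x::'a::cstar_algebra) \<le> t"
  shows "norm (t *\<^sub>R 1 - x) \<le> t"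
proof -
  obtain k where k_root: "adj k = k" "x = k * k" using assms(1) by (auto simp: psd_def)
  have "adj (t *\<^sub>R 1 - x) = t *\<^sub>R 1 - x" by (simp add: adj_diff adj_scaleR psd_self_adjoint assms)
  moreover have "norm (t *\<^sub>R 1 - (t *\<^sub>R 1 - x)) \<le> t" using assms by simp
  ultimately obtain m where m_root: "adj m = m" "m * m = t *\<^sub>R 1 - x"
      "\<And>z. z * (t *\<^sub>R 1 - x) = (t *\<^sub>R 1 - x) * z \<Longrightarrow> z * m = m * z"
    using sqrt_exists by metis
  have "m * k = k * m" by (rule m_root(3)[symmetric]) (simp add: k_root algebra_simps)
  then show ?thesis
    using norm_le_of_sum_squares[OF m_root(1) k_root(1), of t] m_root(2) k_root(2)
      order_trans[OF norm_ge_zero assms(2)]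
    by simp
qed

lemma psd_sqrt_exists:
  assumes "psd (x::'a::cstar_algebra)"
  obtains k where "psd k" "k * k = x" "\<And>z. z * x = x * z \<Longrightarrow> z * k = k * z"
proof -
  obtain k where "adj k = k" "k * k = x"
    "norm (sqrt (norm x) *\<^sub>R 1 - k) \<le> sqrt (norm x)" "\<And>z. z * x = x * z \<Longrightarrow> z * k = k * z"
    using sqrt_exists[OF psd_self_adjoint[OF assms] norm_scalar_diff_psd_le[OF assms order_refl]]
    by metis
  then show ?thesis using that psd_of_norm by blast
qed

lemma psd_0 [simp]: "psd (0::'a::cstar_algebra)"
  using psd_square[of "0::'a"] by simp

lemma psd_add:
  assumes "psd x" "psd (y::'a::cstar_algebra)" shows "psd (x + y)"
proof (rule psd_of_norm[of _ "norm x + norm y"])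
  show "adj (x + y) = x + y" using assms by (simp add: adj_add psd_self_adjoint)
  have "(norm x + norm y) *\<^sub>R 1 - (x + y) = (norm x *\<^sub>R 1 - x) + (norm y *\<^sub>R 1 - y)"
    by (simp add: algebra_simps)
  also have "norm \<dots> \<le> norm x + norm y"
    by (intro norm_triangle_mono norm_scalar_diff_psd_le assms order_refl)
  finally show "norm ((norm x + norm y) *\<^sub>R 1 - (x + y)) \<le> norm x + norm y" .
qed

lemma psd_sum: "(\<And>i. i \<in> S \<Longrightarrow> psd (f i :: 'a::cstar_algebra)) \<Longrightarrow> psd (sum f S)"
  by (induction S rule: infinite_finite_induct) (auto intro: psd_add)

lemma psd_scaleR:
  assumes "psd x" "c \<ge> 0" shows "psd (c *\<^sub>R (x::'a::cstar_algebra))"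
proof -
  obtain k where "adj k = k" "x = k * k" using assms(1) by (auto simp: psd_def)
  then have "c *\<^sub>R x = (sqrt c *\<^sub>R k) * (sqrt c *\<^sub>R k)" using assms(2) by simp
  then show ?thesis using psd_square[of "sqrt c *\<^sub>R k"] \<open>adj k = k\<close> by (simp add: adj_scaleR)
qed

lemma self_adjoint_le_scalar: "adj x = x \<Longrightarrow> norm x \<le> t \<Longrightarrow> x \<preceq> t *\<^sub>R (1::'a::cstar_algebra)"
  by (rule psd_of_norm[of _ t]) (auto simp: adj_diff adj_scaleR)

lemma norm_le_of_le_scalar:
  assumes "psd p" "p \<preceq> t *\<^sub>R (1::'a::cstar_algebra)" "t \<ge> 0"
  shows "norm p \<le> t"
proof -
  obtain k where k_root: "psd k" "k * k = p" "\<And>z. z * p = p * z \<Longrightarrow> z * k = k * z"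
    using psd_sqrt_exists[OF assms(1)] by metis
  obtain m where m_root: "adj m = m" "t *\<^sub>R 1 - p = m * m" using assms(2) by (auto simp: psd_def)
  have p_eq: "p = t *\<^sub>R 1 - m * m" using m_root(2) by (simp add: algebra_simps)
  have "k * m = m * k" by (rule k_root(3)[symmetric]) (simp add: p_eq algebra_simps)
  moreover have "k * k + m * m = t *\<^sub>R 1" by (simp add: k_root(2) p_eq)
  ultimately show ?thesis
    using norm_le_of_sum_squares[OF psd_self_adjoint[OF k_root(1)] m_root(1)] k_root(2) assms(3)
    by metis
qed

lemma norm_mono_psd:
  assumes "psd p" "p \<preceq> (q::'a::cstar_algebra)"
  shows "norm p \<le> norm q"
proof (rule norm_le_of_le_scalar[OF assms(1)])
  have "psd q" using psd_add[OF assms] by simp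
  then have "q \<preceq> norm q *\<^sub>R 1" by (intro self_adjoint_le_scalar psd_self_adjoint) auto
  from psd_add[OF this assms(2)] show "p \<preceq> norm q *\<^sub>R 1" by simp
qed simp

lemma psd_antisym:
  assumes "psd x" "psd (- x)" shows "x = (0::'a::cstar_algebra)"
  using norm_mono_psd[OF assms(1), of 0] assms(2) by simp

lemma psd_mult_square_commute:
  assumes "psd p" "adj n = n" "n * p = p * (n::'a::cstar_algebra)"
  shows "psd (p * (n * n))"
proof -
  obtain k where k_root: "psd k" "k * k = p" "\<And>z. z * p = p * z \<Longrightarrow> z * k = k * z"
    using psd_sqrt_exists[OF assms(1)] by metis
  have commute: "n * k = k * n" by (rule k_root(3)[OF assms(3)])
  have "adj (k * n) = k * n" by (simp add: adj_mult assms(2) psd_self_adjoint[OF k_root(1)] commute)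
  moreover have "p * (n * n) = (k * n) * (k * n)"
    unfolding k_root(2)[symmetric] by (metis commute mult.assoc)
  ultimately show ?thesis using psd_square by metis
qed

lemma le_of_power_le_linear_mult_power:
  fixes s t :: real
  assumes power_le: "\<And>k. s ^ 2 ^ k \<le> (2 ^ k + 1) * t ^ 2 ^ k" and t_nonneg: "t \<ge> 0"
  shows "s \<le> t"
proof (rule ccontr)
  assume "\<not> s \<le> t"
  define x where "x = t / s"
  have x_range: "0 \<le> x" "x < 1" using \<open>\<not> s \<le> t\<close> t_nonneg by (simp_all add: x_def)
  have "(\<lambda>n. real n * x ^ n + x ^ n) \<longlonglongrightarrow> 0 + 0"
    using x_range by (intro tendsto_add powser_times_n_limit_0 LIMSEQ_power_zero) auto
  moreover have "strict_mono (\<lambda>k. 2 ^ k :: nat)" by (simp add: strict_mono_def)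
  ultimately have "((\<lambda>n. real n * x ^ n + x ^ n) \<circ> (\<lambda>k. 2 ^ k)) \<longlonglongrightarrow> 0"
    by (simp add: LIMSEQ_subseq_LIMSEQ)
  moreover have "1 \<le> ((\<lambda>n. real n * x ^ n + x ^ n) \<circ> (\<lambda>k. 2 ^ k)) k" for k
    using power_le[of k] \<open>\<not> s \<le> t\<close> t_nonneg by (simp add: x_def field_simps)
  ultimately have "(1::real) \<le> 0" by (intro LIMSEQ_le_const) auto
  then show False by simp
qed

text \<open>With \<open>t = \<parallel>y\<parallel>\<^sup>2\<close>, the powers of \<open>h = t - y\<^sup>* y\<close> reduce to powers of \<open>q = t - y y\<^sup>*\<close> by
  \<open>h\<^sup>n y\<^sup>* = y\<^sup>* q\<^sup>n\<close>. Since \<open>\<parallel>q\<parallel> \<le> t\<close>, they grow at most like \<open>n t\<^sup>n\<close>, which forces \<open>\<parallel>h\<parallel> \<le> t\<close>.\<close>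
lemma psd_adj_mult_swap:
  fixes y :: "'a::cstar_algebra"
  assumes "psd (y * adj y)"
  shows "psd (adj y * y)"
proof -
  define t where "t = (norm y)\<^sup>2"
  have t_nonneg: "t \<ge> 0" by (simp add: t_def)
  define q h where "q = t *\<^sub>R 1 - y * adj y" and "h = t *\<^sub>R 1 - adj y * y"
  have "norm (y * adj y) = t" using norm_adj_mult_self[of "adj y"] by (simp add: t_def)
  then have norm_q: "norm q \<le> t" unfolding q_def by (intro norm_scalar_diff_psd_le assms) simp
  have adj_h: "adj h = h" by (simp add: h_def adj_diff adj_scaleR adj_mult)
  have intertwine: "h ^ n * adj y = adj y * q ^ n" for n
  proof (induction n)
    case (Suc n)
    have "h * adj y = adj y * q" by (simp add: h_def q_def algebra_simps)
    then show ?case using Suc by (metis mult.assoc power_Suc power_commutes)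
  qed simp
  have "norm (h ^ n) \<le> (real n + 1) * t ^ n" for n
  proof (induction n)
    case (Suc n)
    have "h ^ Suc n = t *\<^sub>R h ^ n - h ^ n * adj y * y"
      by (subst power_Suc2) (simp add: h_def algebra_simps)
    also have "\<dots> = t *\<^sub>R h ^ n - adj y * q ^ n * y" by (simp only: intertwine)
    finally have "norm (h ^ Suc n) \<le> norm (t *\<^sub>R h ^ n) + norm (adj y * q ^ n * y)"
      by (metis norm_triangle_ineq4)
    also have "norm (adj y * q ^ n * y) \<le> norm y * t ^ n * norm y"
      by (intro order_trans[OF norm_mult_ineq] mult_mono order_trans[OF norm_power_ineq] power_mono
          norm_q)
        (auto simp: t_nonneg)
    also have "\<dots> = t * t ^ n" by (simp add: t_def power2_eq_square)
    also have "norm (t *\<^sub>R h ^ n) \<le> t * ((real n + 1) * t ^ n)"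
      using Suc t_nonneg by (simp add: mult_left_mono)
    finally show ?case by (simp add: algebra_simps)
  qed simp
  from this[of "2 ^ _"] have "norm h ^ 2 ^ k \<le> (2 ^ k + 1) * t ^ 2 ^ k" for k
    by (simp add: norm_self_adjoint_power2[OF adj_h])
  then have "norm h \<le> t" using t_nonneg by (rule le_of_power_le_linear_mult_power)
  then show ?thesis
    unfolding h_def by (rule psd_of_norm[rotated]) (simp add: adj_mult)
qed

lemma eq_0_of_psd_minus_adj_mult:
  fixes y :: "'a::cstar_algebra"
  assumes "psd (- (adj y * y))"
  shows "y = 0"
proof -
  define r s where "r = y + adj y" and "s = i_times (y - adj y)"
  have adj_r: "adj r = r" by (simp add: r_def adj_add add.commute)
  have adj_s: "adj s = s" by (simp add: s_def adj_i_times adj_diff cscale_minus_right[symmetric])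
  have "r * r + s * s = 2 *\<^sub>R (y * adj y + adj y * y)"
    by (simp add: r_def s_def algebra_simps cscale_mult_left cscale_mult_right cscale_diff_right
        cscale_add_right i_times_i_times scaleR_2)
  then have "y * adj y = (1/2) *\<^sub>R (r * r + s * s) + - (adj y * y)" by simp
  moreover have "psd \<dots>" by (intro psd_add psd_scaleR psd_square adj_r adj_s assms) simp
  ultimately have "psd (y * adj y)" by (simp only:)
  then have "adj y * y = 0" using assms by (intro psd_antisym psd_adj_mult_swap)
  then show ?thesis using norm_adj_mult_self[of y] by simp
qed

text \<open>For self-adjoint \<open>h\<close> with absolute value \<open>p\<close>, the element \<open>n = p - h\<close> (twice the negative part)
  satisfies \<open>n h n = - p n\<^sup>2\<close>, so \<open>(x n)\<^sup>* (x n)\<close> is negative.\<close>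
lemma psd_adj_mult: "psd (adj x * (x::'a::cstar_algebra))"
proof -
  define h where "h = adj x * x"
  have adj_h: "adj h = h" by (simp add: h_def adj_mult)
  obtain p where p_root: "psd p" "p * p = h * h" "\<And>z. z * (h * h) = h * h * z \<Longrightarrow> z * p = p * z"
    using psd_sqrt_exists[OF psd_square[OF adj_h]] by metis
  have h_p_commute: "h * p = p * h" by (rule p_root(3)) (simp add: mult.assoc)
  define n where "n = p - h"
  have adj_n: "adj n = n" by (simp add: n_def adj_diff adj_h psd_self_adjoint[OF p_root(1)])
  have n_p_commute: "n * p = p * n" by (simp add: n_def algebra_simps h_p_commute)
  have h_mult_n: "h * n = - (p * n)" by (simp add: n_def algebra_simps p_root(2) h_p_commute)
  have n_square: "n * n = 2 *\<^sub>R (p * n)"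
    by (simp add: n_def algebra_simps p_root(2) h_p_commute scaleR_2)
  have "adj (x * n) * (x * n) = n * (h * n)" by (simp add: adj_mult adj_n h_def mult.assoc)
  also have "\<dots> = - (p * (n * n))" unfolding h_mult_n
    by (simp add: n_p_commute mult.assoc[symmetric])
  finally have xn_square: "adj (x * n) * (x * n) = - (p * (n * n))" .
  then have "psd (- (adj (x * n) * (x * n)))"
    using psd_mult_square_commute[OF p_root(1) adj_n n_p_commute] by simp
  then have "x * n = 0" by (rule eq_0_of_psd_minus_adj_mult)
  then have "p * (n * n) = 0" using xn_square by simp
  moreover have "n * n * n = 2 *\<^sub>R (p * (n * n))" by (subst n_square) (simp add: mult.assoc)
  ultimately have "n * n * n * n = 0" by simp
  then have "norm n = 0"
    using norm_self_adjoint_square[OF adj_n] norm_self_adjoint_square[of "n * n"] adj_n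
    by (simp add: adj_mult mult.assoc)
  then show ?thesis using p_root(1) by (simp add: n_def h_def)
qed

lemma psd_conj:
  assumes "psd (p::'a::cstar_algebra)" shows "psd (adj z * p * z)"
proof -
  obtain k where "adj k = k" "p = k * k" using assms by (auto simp: psd_def)
  then have "adj z * p * z = adj (k * z) * (k * z)" by (simp add: adj_mult mult.assoc)
  then show ?thesis using psd_adj_mult by metis
qed

lemma conj_le_scaleR_adj_mult:
  assumes "adj p = (p::'a::cstar_algebra)" "norm p \<le> c"
  shows "adj z * p * z \<preceq> c *\<^sub>R (adj z * z)"
  using psd_conj[OF self_adjoint_le_scalar[OF assms], of z] by (simp add: algebra_simps)

section \<open>The Hilbert module \<open>A\<^sup>I\<close>\<close>

abbreviation ip :: "'i set \<Rightarrow> ('i \<Rightarrow> 'a::cstar_algebra) \<Rightarrow> ('i \<Rightarrow> 'a) \<Rightarrow> 'a" where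
  "ip I u v \<equiv> \<Sum>i\<in>I. adj (u i) * v i"

definition hnorm :: "'i set \<Rightarrow> ('i \<Rightarrow> 'a::cstar_algebra) \<Rightarrow> real" where
  "hnorm I u = sqrt (norm (ip I u u))"

lemma hnorm_nonneg [simp]: "0 \<le> hnorm I u"
  by (simp add: hnorm_def)

lemma hnorm_power2: "(hnorm I u)\<^sup>2 = norm (ip I u u)"
  by (simp add: hnorm_def)

lemma hnorm_0 [simp]: "hnorm I (\<lambda>i. 0) = 0"
  by (simp add: hnorm_def)

lemma hnorm_cong: "(\<And>i. i \<in> I \<Longrightarrow> u i = v i) \<Longrightarrow> hnorm I u = hnorm I v"
  by (simp add: hnorm_def)

lemma adj_ip: "adj (ip I u v) = ip I v u"
  by (simp add: adj_sum adj_mult)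

lemma psd_ip: "psd (ip I u u)"
  by (intro psd_sum psd_adj_mult)

lemma le_mult_of_forall_greater:
  fixes a b t :: real
  assumes "\<And>c. c > t \<Longrightarrow> a \<le> c * b"
  shows "a \<le> t * b"
proof (rule tendsto_lowerbound)
  show "((\<lambda>c. c * b) \<longlongrightarrow> t * b) (at_right t)" by (intro tendsto_intros)
  show "\<forall>\<^sub>F c in at_right t. a \<le> c * b"
    using eventually_at_right_less[of t] by eventually_elim (rule assms)
qed simp

text \<open>Expand \<open>\<langle>u a - v, u a - v\<rangle> \<ge> 0\<close> for \<open>a = \<langle>u, v\<rangle> / c\<close> with \<open>c > \<parallel>\<langle>u, u\<rangle>\<parallel>\<close>.\<close>
lemma Cauchy_Schwarz_ip: "norm (ip I u v) \<le> hnorm I u * hnorm I v"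
proof -
  let ?X = "ip I u u" and ?Y = "ip I v v" and ?Z = "ip I u v"
  have "(norm ?Z)\<^sup>2 \<le> c * norm ?Y" if c_greater: "c > norm ?X" for c
  proof -
    have c_pos: "c > 0" using c_greater norm_ge_zero[of ?X] by linarith
    define a where "a = inverse c *\<^sub>R ?Z"
    have "ip I (\<lambda>i. u i * a - v i) (\<lambda>i. u i * a - v i)
          = adj a * ?X * a - adj a * ?Z - adj ?Z * a + ?Y"
      unfolding adj_ip
      by (simp add: adj_diff adj_mult algebra_simps sum.distrib sum_subtractf sum_distrib_left
          sum_distrib_right)
    then have "psd (adj a * ?X * a - adj a * ?Z - adj ?Z * a + ?Y)" using psd_ip by metis
    moreover have "adj a * ?X * a \<preceq> c *\<^sub>R (adj a * a)"
      by (rule conj_le_scaleR_adj_mult) (use c_greater in \<open>auto simp: adj_ip\<close>)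
    ultimately have "psd ((adj a * ?X * a - adj a * ?Z - adj ?Z * a + ?Y)
        + (c *\<^sub>R (adj a * a) - adj a * ?X * a))"
      by (rule psd_add)
    also have "(adj a * ?X * a - adj a * ?Z - adj ?Z * a + ?Y)
        + (c *\<^sub>R (adj a * a) - adj a * ?X * a)
        = ?Y - inverse c *\<^sub>R (adj ?Z * ?Z)"
      using c_pos by (simp add: a_def adj_scaleR algebra_simps)
    finally have "inverse c *\<^sub>R (adj ?Z * ?Z) \<preceq> ?Y" .
    then have "norm (inverse c *\<^sub>R (adj ?Z * ?Z)) \<le> norm ?Y"
      using c_pos by (intro norm_mono_psd psd_scaleR psd_adj_mult) auto
    then show ?thesis using c_pos by (simp add: norm_adj_mult_self field_simps)
  qed
  then have "(norm ?Z)\<^sup>2 \<le> norm ?X * norm ?Y" by (rule le_mult_of_forall_greater)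
  then have "(norm ?Z)\<^sup>2 \<le> (hnorm I u * hnorm I v)\<^sup>2" by (simp add: power_mult_distrib hnorm_power2)
  then show ?thesis by (simp add: power2_le_iff_abs_le)
qed

lemma hnorm_triangle: "hnorm I (\<lambda>i. u i + v i) \<le> hnorm I u + hnorm I v"
proof -
  have "ip I (\<lambda>i. u i + v i) (\<lambda>i. u i + v i) = ip I u u + ip I u v + ip I v u + ip I v v"
    by (simp add: adj_add algebra_simps sum.distrib)
  then have "(hnorm I (\<lambda>i. u i + v i))\<^sup>2
        \<le> norm (ip I u u) + norm (ip I u v) + norm (ip I v u) + norm (ip I v v)"
    unfolding hnorm_power2 by (auto intro!: order_trans[OF norm_triangle_ineq] add_right_mono)
  also have "\<dots> \<le> (hnorm I u)\<^sup>2 + hnorm I u * hnorm I v + hnorm I v * hnorm I u + (hnorm I v)\<^sup>2"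
    by (intro add_mono Cauchy_Schwarz_ip) (simp_all add: hnorm_power2)
  also have "\<dots> = (hnorm I u + hnorm I v)\<^sup>2" by (simp add: power2_eq_square algebra_simps)
  finally show ?thesis by (rule power2_le_imp_le) simp
qed

lemma hnorm_scaleR: "hnorm I (\<lambda>i. c *\<^sub>R u i) = \<bar>c\<bar> * hnorm I u"
proof -
  have "ip I (\<lambda>i. c *\<^sub>R u i) (\<lambda>i. c *\<^sub>R u i) = c\<^sup>2 *\<^sub>R ip I u u"
    by (simp add: adj_scaleR scaleR_sum_right power2_eq_square)
  then show ?thesis by (simp add: hnorm_def real_sqrt_mult)
qed

lemma hnorm_minus: "hnorm I (\<lambda>i. - u i) = hnorm I u"
  by (simp add: hnorm_def)

lemma hnorm_mono:
  assumes "finite I" "J \<subseteq> I" shows "hnorm J u \<le> hnorm I u"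
proof -
  have "ip I u u - ip J u u = ip (I - J) u u" using assms by (simp add: sum_diff)
  then have "ip J u u \<preceq> ip I u u" using psd_ip by metis
  then show ?thesis unfolding hnorm_def by (simp add: norm_mono_psd[OF psd_ip])
qed

lemma hnorm_restrict:
  assumes "finite I" shows "hnorm I (\<lambda>i. if i \<in> P then u i else 0) = hnorm (I \<inter> P) u"
proof -
  have "ip I (\<lambda>i. if i \<in> P then u i else 0) (\<lambda>i. if i \<in> P then u i else 0) = ip (I \<inter> P) u u"
    using assms by (intro sum.mono_neutral_cong_right) auto
  then show ?thesis by (simp add: hnorm_def)
qed

lemma norm_le_hnorm: "finite I \<Longrightarrow> i \<in> I \<Longrightarrow> norm (u i) \<le> hnorm I u"
  using hnorm_mono[of I "{i}" u] by (simp add: hnorm_def norm_adj_mult_self)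

lemma hnorm_Times_le_sum: "hnorm (J \<times> I) u \<le> (\<Sum>j\<in>J. hnorm I (\<lambda>i. u (j, i)))"
proof -
  have "hnorm (J \<times> I) u \<le> L2_set (\<lambda>j. hnorm I (\<lambda>i. u (j, i))) J"
    unfolding hnorm_def[of "J \<times> I"] L2_set_def hnorm_power2
    by (simp add: sum.cartesian_product' norm_sum)
  also have "\<dots> \<le> (\<Sum>j\<in>J. hnorm I (\<lambda>i. u (j, i)))" by (rule L2_set_le_sum) simp
  finally show ?thesis .
qed

lemma hnorm_le_sum: "hnorm I u \<le> (\<Sum>i\<in>I. norm (u i))"
proof -
  have "hnorm I u \<le> L2_set (\<lambda>i. norm (u i)) I"
    unfolding hnorm_def L2_set_def norm_adj_mult_self[symmetric] by (simp add: norm_sum)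
  also have "\<dots> \<le> (\<Sum>i\<in>I. norm (u i))" by (rule L2_set_le_sum) simp
  finally show ?thesis .
qed

lemma tendsto_hnorm [tendsto_intros]:
  assumes "\<And>i. i \<in> I \<Longrightarrow> ((\<lambda>n. u n i) \<longlongrightarrow> v i) F"
  shows "((\<lambda>n. hnorm I (u n)) \<longlongrightarrow> hnorm I v) F"
  unfolding hnorm_def
  by (intro tendsto_intros bounded_linear.tendsto[OF bounded_linear_adj] assms)

section \<open>Operator bounds for matrices\<close>

abbreviation mat_vec :: "'j set \<Rightarrow> ('i \<Rightarrow> 'j \<Rightarrow> 'a::cstar_algebra) \<Rightarrow> ('j \<Rightarrow> 'a) \<Rightarrow> 'i \<Rightarrow> 'a" where
  "mat_vec J x \<xi> \<equiv> \<lambda>i. \<Sum>j\<in>J. x i j * \<xi> j"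

definition op_bound :: "'i set \<Rightarrow> 'j set \<Rightarrow> ('i \<Rightarrow> 'j \<Rightarrow> 'a::cstar_algebra) \<Rightarrow> real \<Rightarrow> bool" where
  "op_bound I J x C \<longleftrightarrow> 0 \<le> C \<and> (\<forall>\<xi>. hnorm I (mat_vec J x \<xi>) \<le> C * hnorm J \<xi>)"

lemma op_boundI:
  "0 \<le> C \<Longrightarrow> (\<And>\<xi>. hnorm I (mat_vec J x \<xi>) \<le> C * hnorm J \<xi>) \<Longrightarrow> op_bound I J x C"
  by (simp add: op_bound_def)

lemma op_boundD: "op_bound I J x C \<Longrightarrow> hnorm I (mat_vec J x \<xi>) \<le> C * hnorm J \<xi>"
  by (simp add: op_bound_def)

lemma op_bound_nonneg: "op_bound I J x C \<Longrightarrow> 0 \<le> C"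
  by (simp add: op_bound_def)

lemma op_bound_iff_unit_ball:
  "op_bound I J x C \<longleftrightarrow> (\<forall>\<xi>. hnorm J \<xi> \<le> 1 \<longrightarrow> hnorm I (mat_vec J x \<xi>) \<le> C)"
proof (intro iffI allI impI)
  fix \<xi> :: "'b \<Rightarrow> 'c" assume x_bound: "op_bound I J x C" and "hnorm J \<xi> \<le> 1"
  then have "C * hnorm J \<xi> \<le> C" using op_bound_nonneg[OF x_bound] by (simp add: mult_left_le)
  then show "hnorm I (mat_vec J x \<xi>) \<le> C" using op_boundD[OF x_bound, of \<xi>] by linarith
next
  assume unit: "\<forall>\<xi>. hnorm J \<xi> \<le> 1 \<longrightarrow> hnorm I (mat_vec J x \<xi>) \<le> C"
  show "op_bound I J x C"
  proof (rule op_boundI)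
    show "0 \<le> C" using unit[rule_format, of "\<lambda>_. 0"] by simp
    fix \<xi> :: "'b \<Rightarrow> 'c"
    have "hnorm I (mat_vec J x \<xi>) \<le> c * C" if "c > hnorm J \<xi>" for c
    proof -
      have c_pos: "c > 0" using that hnorm_nonneg[of J \<xi>] by linarith
      then have "hnorm J (\<lambda>j. inverse c *\<^sub>R \<xi> j) \<le> 1" using that
        by (simp add: hnorm_scaleR field_simps)
      with unit have "hnorm I (mat_vec J x (\<lambda>j. inverse c *\<^sub>R \<xi> j)) \<le> C" by blast
      then have "inverse c * hnorm I (mat_vec J x \<xi>) \<le> C"
        using c_pos by (simp add: scaleR_sum_right[symmetric] hnorm_scaleR)
      then show ?thesis using c_pos by (simp add: field_simps)
    qed
    then have "hnorm I (mat_vec J x \<xi>) \<le> hnorm J \<xi> * C" by (rule le_mult_of_forall_greater)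
    then show "hnorm I (mat_vec J x \<xi>) \<le> C * hnorm J \<xi>" by (simp add: mult.commute)
  qed
qed

lemma op_bound_cong:
  assumes "\<And>i j. i \<in> I \<Longrightarrow> j \<in> J \<Longrightarrow> x i j = y i j"
  shows "op_bound I J x C \<longleftrightarrow> op_bound I J y C"
proof -
  have "hnorm I (mat_vec J x \<xi>) = hnorm I (mat_vec J y \<xi>)" for \<xi>
    by (rule hnorm_cong) (simp add: assms)
  then show ?thesis by (simp add: op_bound_def)
qed

lemma op_bound_mono: "op_bound I J x C \<Longrightarrow> C \<le> D \<Longrightarrow> op_bound I J x D"
  unfolding op_bound_def by (meson hnorm_nonneg mult_right_mono order_trans)

lemma op_bound_0: "0 \<le> C \<Longrightarrow> op_bound I J (\<lambda>i j. 0) C"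
  by (simp add: op_bound_def)

lemma op_bound_add:
  assumes "op_bound I J x C" "op_bound I J y D"
  shows "op_bound I J (\<lambda>i j. x i j + y i j) (C + D)"
proof (rule op_boundI)
  show "0 \<le> C + D" using assms by (simp add: op_bound_def)
  fix \<xi>
  have "hnorm I (mat_vec J (\<lambda>i j. x i j + y i j) \<xi>)
        \<le> hnorm I (mat_vec J x \<xi>) + hnorm I (mat_vec J y \<xi>)"
    using hnorm_triangle[of I "mat_vec J x \<xi>" "mat_vec J y \<xi>"]
    by (simp add: distrib_right sum.distrib)
  also have "\<dots> \<le> C * hnorm J \<xi> + D * hnorm J \<xi>" by (intro add_mono op_boundD assms)
  finally show "hnorm I (mat_vec J (\<lambda>i j. x i j + y i j) \<xi>) \<le> (C + D) * hnorm J \<xi>"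
    by (simp add: distrib_right)
qed

lemma op_bound_minus: "op_bound I J x C \<Longrightarrow> op_bound I J (\<lambda>i j. - x i j) C"
  by (simp add: op_bound_def sum_negf hnorm_minus)

lemma op_bound_diff:
  "op_bound I J x C \<Longrightarrow> op_bound I J y D \<Longrightarrow> op_bound I J (\<lambda>i j. x i j - y i j) (C + D)"
  using op_bound_add[OF _ op_bound_minus, of I J x C y D] by simp

lemma op_bound_mult:
  assumes x_bound: "op_bound I K x C" and y_bound: "op_bound K J y D"
  shows "op_bound I J (\<lambda>i j. \<Sum>k\<in>K. x i k * y k j) (C * D)"
proof (rule op_boundI)
  show "0 \<le> C * D" using assms by (simp add: op_bound_def)
  fix \<xi>
  have "hnorm I (mat_vec J (\<lambda>i j. \<Sum>k\<in>K. x i k * y k j) \<xi>) = hnorm I (mat_vec K x (mat_vec J y \<xi>))"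
    by (rule hnorm_cong) (simp add: sum_distrib_left sum_distrib_right mult.assoc, rule sum.swap)
  also have "\<dots> \<le> C * hnorm K (mat_vec J y \<xi>)" by (rule op_boundD[OF x_bound])
  also have "\<dots> \<le> C * (D * hnorm J \<xi>)"
    by (rule mult_left_mono[OF op_boundD[OF y_bound] op_bound_nonneg[OF x_bound]])
  finally show "hnorm I (mat_vec J (\<lambda>i j. \<Sum>k\<in>K. x i k * y k j) \<xi>) \<le> C * D * hnorm J \<xi>"
    by (simp add: mult.assoc)
qed

lemma ip_mat_vec: "ip I (mat_vec J x \<xi>) \<eta> = ip J \<xi> (mat_vec I (\<lambda>j i. adj (x i j)) \<eta>)"
  by (simp add: adj_sum adj_mult sum_distrib_left sum_distrib_right mult.assoc)
    (rule sum.swap)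

lemma le_of_power2_le_mult: "(h::real)\<^sup>2 \<le> c * h \<Longrightarrow> 0 \<le> c \<Longrightarrow> h \<le> c"
  by (cases "0 < h") (auto simp: power2_eq_square)

lemma op_bound_adj:
  assumes "op_bound I J x C"
  shows "op_bound J I (\<lambda>j i. adj (x i j)) C"
proof (rule op_boundI)
  show C_nonneg: "0 \<le> C" using assms by (rule op_bound_nonneg)
  fix \<xi>
  define \<eta> where "\<eta> = mat_vec I (\<lambda>j i. adj (x i j)) \<xi>"
  have "ip J \<eta> \<eta> = ip I \<xi> (mat_vec J x \<eta>)"
    using ip_mat_vec[where x = "\<lambda>j i. adj (x i j)" and \<xi> = \<xi> and \<eta> = \<eta> and I = J and J = I]
    by (simp add: \<eta>_def)
  then have "(hnorm J \<eta>)\<^sup>2 = norm (ip I \<xi> (mat_vec J x \<eta>))" by (simp only: hnorm_power2)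
  also have "\<dots> \<le> hnorm I \<xi> * (C * hnorm J \<eta>)"
    by (rule order_trans[OF Cauchy_Schwarz_ip mult_left_mono[OF op_boundD[OF assms]]]) simp
  finally have "(hnorm J \<eta>)\<^sup>2 \<le> C * hnorm I \<xi> * hnorm J \<eta>" by (simp add: algebra_simps)
  then have "hnorm J \<eta> \<le> C * hnorm I \<xi>" by (rule le_of_power2_le_mult) (simp add: C_nonneg)
  then show "hnorm J (mat_vec I (\<lambda>j i. adj (x i j)) \<xi>) \<le> C * hnorm I \<xi>" by (simp only: \<eta>_def)
qed

lemma op_bound_cstar_identity:
  assumes "op_bound J J (\<lambda>j k. \<Sum>i\<in>I. adj (x i j) * x i k) (C\<^sup>2)" "0 \<le> C"
  shows "op_bound I J x C"
proof (rule op_boundI)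
  fix \<xi>
  let ?y = "\<lambda>j k. \<Sum>i\<in>I. adj (x i j) * x i k"
  have "mat_vec I (\<lambda>j i. adj (x i j)) (mat_vec J x \<xi>) j = mat_vec J ?y \<xi> j" for j
    by (simp add: sum_distrib_left sum_distrib_right mult.assoc) (rule sum.swap)
  then have "(hnorm I (mat_vec J x \<xi>))\<^sup>2 = norm (ip J \<xi> (mat_vec J ?y \<xi>))"
    unfolding hnorm_power2 ip_mat_vec by (simp only:)
  also have "\<dots> \<le> hnorm J \<xi> * (C\<^sup>2 * hnorm J \<xi>)"
    by (rule order_trans[OF Cauchy_Schwarz_ip mult_left_mono[OF op_boundD[OF assms(1)]]]) simp
  also have "\<dots> = (C * hnorm J \<xi>)\<^sup>2" by (simp add: power2_eq_square)
  finally show "hnorm I (mat_vec J x \<xi>) \<le> C * hnorm J \<xi>"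
    by (rule power2_le_imp_le) (simp add: assms(2))
qed (rule assms(2))

lemma op_bound_restrict:
  assumes "finite I" "finite J" "op_bound (I \<inter> P) (J \<inter> Q) x C"
  shows "op_bound I J (\<lambda>i j. if i \<in> P \<and> j \<in> Q then x i j else 0) C"
proof (rule op_boundI)
  show "0 \<le> C" using assms(3) by (rule op_bound_nonneg)
  fix \<xi>
  have "hnorm I (mat_vec J (\<lambda>i j. if i \<in> P \<and> j \<in> Q then x i j else 0) \<xi>)
      = hnorm I (\<lambda>i. if i \<in> P then mat_vec (J \<inter> Q) x \<xi> i else 0)"
    using assms(2) by (intro hnorm_cong) (auto intro!: sum.mono_neutral_cong_right split: if_splits)
  also have "\<dots> = hnorm (I \<inter> P) (mat_vec (J \<inter> Q) x \<xi>)" by (rule hnorm_restrict[OF assms(1)])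
  also have "\<dots> \<le> C * hnorm (J \<inter> Q) \<xi>" by (rule op_boundD[OF assms(3)])
  also have "\<dots> \<le> C * hnorm J \<xi>" by (intro mult_left_mono hnorm_mono assms(2) \<open>0 \<le> C\<close>) simp
  finally show "hnorm I (mat_vec J (\<lambda>i j. if i \<in> P \<and> j \<in> Q then x i j else 0) \<xi>) \<le> C * hnorm J \<xi>" .
qed

lemma op_bound_subset:
  assumes "op_bound I J x C" "finite I" "finite J" "I' \<subseteq> I" "J' \<subseteq> J"
  shows "op_bound I' J' x C"
proof (rule op_boundI)
  show "0 \<le> C" using assms(1) by (rule op_bound_nonneg)
  fix \<xi> :: "'b \<Rightarrow> 'c"
  let ?\<xi> = "\<lambda>j. if j \<in> J' then \<xi> j else 0"
  have "hnorm I' (mat_vec J' x \<xi>) = hnorm I' (mat_vec J x ?\<xi>)"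
    using assms(3,5) by (intro hnorm_cong sum.mono_neutral_cong_left) auto
  also have "\<dots> \<le> hnorm I (mat_vec J x ?\<xi>)" by (rule hnorm_mono[OF assms(2,4)])
  also have "\<dots> \<le> C * hnorm J ?\<xi>" by (rule op_boundD[OF assms(1)])
  also have "hnorm J ?\<xi> = hnorm J' \<xi>" using assms(3,5) by (simp add: hnorm_restrict Int_absorb1)
  finally show "hnorm I' (mat_vec J' x \<xi>) \<le> C * hnorm J' \<xi>" .
qed

lemma op_bound_sum_norm:
  assumes "finite J"
  shows "op_bound I J x (\<Sum>i\<in>I. \<Sum>j\<in>J. norm (x i j))"
proof (rule op_boundI)
  fix \<xi>
  have "hnorm I (mat_vec J x \<xi>) \<le> (\<Sum>i\<in>I. norm (mat_vec J x \<xi> i))" by (rule hnorm_le_sum)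
  also have "\<dots> \<le> (\<Sum>i\<in>I. \<Sum>j\<in>J. norm (x i j) * hnorm J \<xi>)"
    using assms
    by (intro sum_mono order_trans[OF norm_sum] order_trans[OF norm_mult_ineq] mult_left_mono
        norm_le_hnorm) auto
  finally show "hnorm I (mat_vec J x \<xi>) \<le> (\<Sum>i\<in>I. \<Sum>j\<in>J. norm (x i j)) * hnorm J \<xi>"
    by (simp add: sum_distrib_right)
qed (simp add: sum_nonneg)

lemma op_bound_column:
  assumes "op_bound I J x C" "finite J" "j \<in> J"
  shows "hnorm I (\<lambda>i. x i j) \<le> C"
proof -
  let ?\<xi> = "\<lambda>k. if k \<in> {j} then 1 else 0 :: 'c"
  have "mat_vec J x ?\<xi> = (\<lambda>i. x i j)"
    using assms(2,3) by (simp add: if_distrib sum.delta cong: if_cong)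
  moreover have "hnorm J ?\<xi> = 1"
    using assms(2,3) by (subst hnorm_restrict) (simp_all add: hnorm_def Int_absorb1)
  ultimately show ?thesis using op_boundD[OF assms(1), of ?\<xi>] by simp
qed

lemma op_bound_entry:
  assumes "op_bound I J x C" "finite I" "finite J" "i \<in> I" "j \<in> J"
  shows "norm (x i j) \<le> C"
  using norm_le_hnorm[OF assms(2,4)] op_bound_column[OF assms(1,3,5)] by (rule order_trans)

lemma op_bound_limit:
  assumes "F \<noteq> bot" "\<forall>\<^sub>F n in F. op_bound I J (x n) C"
    and lim: "\<And>i j. i \<in> I \<Longrightarrow> j \<in> J \<Longrightarrow> ((\<lambda>n. x n i j) \<longlongrightarrow> y i j) F"
  shows "op_bound I J y C"
proof (rule op_boundI)
  show "0 \<le> C"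
    using eventually_happens'[OF assms(1,2)] by (auto simp: op_bound_def)
  fix \<xi>
  show "hnorm I (mat_vec J y \<xi>) \<le> C * hnorm J \<xi>"
  proof (rule tendsto_upperbound[OF _ _ assms(1)])
    show "((\<lambda>n. hnorm I (mat_vec J (x n) \<xi>)) \<longlongrightarrow> hnorm I (mat_vec J y \<xi>)) F"
      by (intro tendsto_intros lim)
    show "\<forall>\<^sub>F n in F. hnorm I (mat_vec J (x n) \<xi>) \<le> C * hnorm J \<xi>"
      using assms(2) by eventually_elim (rule op_boundD)
  qed
qed

lemma eventually_op_bound_perturb:
  assumes finite_I: "finite I" and finite_J: "finite J"
    and x_bound: "\<forall>\<^sub>F n in F. op_bound I J (x n) C" and e_pos: "e > 0"
    and null: "\<And>i j. i \<in> I \<Longrightarrow> j \<in> J \<Longrightarrow> ((\<lambda>n. y n i j - x n i j) \<longlongrightarrow> 0) F"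
  shows "\<forall>\<^sub>F n in F. op_bound I J (y n) (C + e)"
proof -
  have "((\<lambda>n. \<Sum>i\<in>I. \<Sum>j\<in>J. norm (y n i j - x n i j)) \<longlongrightarrow> (\<Sum>i\<in>I. \<Sum>j\<in>J. norm (0::'d))) F"
    by (intro tendsto_intros null)
  then have "\<forall>\<^sub>F n in F. (\<Sum>i\<in>I. \<Sum>j\<in>J. norm (y n i j - x n i j)) < e"
    by (rule order_tendstoD) (use e_pos in simp)
  with x_bound show ?thesis
  proof eventually_elim
    case (elim n)
    have "op_bound I J (\<lambda>i j. y n i j - x n i j) e"
      using op_bound_mono[OF op_bound_sum_norm[OF finite_J] less_imp_le[OF elim(2)]] .
    from op_bound_add[OF elim(1) this] show ?case by simp
  qed
qed

definition block_diag :: "('j \<Rightarrow> 'i \<Rightarrow> 'k \<Rightarrow> 'a::zero) \<Rightarrow> 'j \<times> 'i \<Rightarrow> 'j \<times> 'k \<Rightarrow> 'a" where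
  "block_diag x p q = (if fst p = fst q then x (fst p) (snd p) (snd q) else 0)"

lemma mat_vec_block_diag:
  assumes "finite J" "j \<in> J"
  shows "mat_vec (J \<times> K) (block_diag x) \<xi> (j, i) = mat_vec K (x j) (\<lambda>k. \<xi> (j, k)) i"
proof -
  have "mat_vec (J \<times> K) (block_diag x) \<xi> (j, i)
      = (\<Sum>j'\<in>J. if j = j' then mat_vec K (x j) (\<lambda>k. \<xi> (j, k)) i else 0)"
    unfolding sum.cartesian_product' by (intro sum.cong) (auto simp: block_diag_def)
  then show ?thesis using assms by simp
qed

lemma block_diag_adj_mult:
  assumes "finite J" "fst p \<in> J"
  shows "(\<Sum>r\<in>J \<times> I. adj (block_diag x r p) * block_diag x r q)
      = block_diag (\<lambda>j k l. \<Sum>i\<in>I. adj (x j i k) * x j i l) p q"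
proof -
  have "(\<Sum>r\<in>J \<times> I. adj (block_diag x r p) * block_diag x r q)
      = (\<Sum>j\<in>J. if j = fst p then \<Sum>i\<in>I. adj (x j i (snd p)) * block_diag x (j, i) q else 0)"
    unfolding sum.cartesian_product' by (intro sum.cong) (auto simp: block_diag_def)
  then show ?thesis using assms by (simp add: block_diag_def)
qed

lemma op_bound_block_diag_card:
  fixes x :: "'j \<Rightarrow> 'i \<Rightarrow> 'k \<Rightarrow> 'a::cstar_algebra"
  assumes finite_J: "finite J" and finite_K: "finite K" and C_nonneg: "0 \<le> C"
    and x_bound: "\<And>j. j \<in> J \<Longrightarrow> op_bound I K (x j) C"
  shows "op_bound (J \<times> I) (J \<times> K) (block_diag x) (real (card J) * C)"
proof (rule op_boundI)
  fix \<xi> :: "'j \<times> 'k \<Rightarrow> 'a"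
  have "hnorm I (mat_vec K (x j) (\<lambda>k. \<xi> (j, k))) \<le> C * hnorm (J \<times> K) \<xi>" if "j \<in> J" for j
  proof -
    have "hnorm I (mat_vec K (x j) (\<lambda>k. \<xi> (j, k))) \<le> C * hnorm K (\<lambda>k. \<xi> (j, k))"
      by (rule op_boundD[OF x_bound[OF that]])
    also have "hnorm K (\<lambda>k. \<xi> (j, k)) = hnorm ({j} \<times> K) \<xi>"
      by (simp add: hnorm_def sum.cartesian_product')
    also have "C * \<dots> \<le> C * hnorm (J \<times> K) \<xi>"
      using finite_J finite_K that C_nonneg by (intro mult_left_mono hnorm_mono) auto
    finally show ?thesis .
  qed
  then have "(\<Sum>j\<in>J. hnorm I (mat_vec K (x j) (\<lambda>k. \<xi> (j, k)))) \<le> (\<Sum>j\<in>J. C * hnorm (J \<times> K) \<xi>)"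
    by (rule sum_mono)
  then show "hnorm (J \<times> I) (mat_vec (J \<times> K) (block_diag x) \<xi>)
      \<le> real (card J) * C * hnorm (J \<times> K) \<xi>"
    using hnorm_Times_le_sum[of J I "mat_vec (J \<times> K) (block_diag x) \<xi>"]
    by (simp add: mat_vec_block_diag[OF finite_J])
qed (simp add: C_nonneg)

text \<open>The triangle inequality alone gives the factor \<open>|J|\<close>, and each passage from \<open>x\<close> to \<open>x\<^sup>* x\<close>
  replaces it by its square root.\<close>
lemma op_bound_block_diag_root:
  assumes finite_J: "finite J" and finite_K: "finite K" and "0 \<le> C"
    and "\<And>j. j \<in> J \<Longrightarrow> op_bound I K (x j :: 'i \<Rightarrow> 'i \<Rightarrow> 'a::cstar_algebra) C"
  shows "op_bound (J \<times> I) (J \<times> K) (block_diag x) (root (2 ^ n) (real (card J)) * C)"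
  using assms(3,4)
proof (induction n arbitrary: x C I)
  case 0
  from op_bound_block_diag_card[OF finite_J finite_K this] show ?case by simp
next
  case (Suc n)
  let ?y = "\<lambda>j k l. \<Sum>i\<in>I. adj (x j i k) * x j i l"
  have "op_bound K K (?y j) (C * C)" if "j \<in> J" for j
    by (intro op_bound_mult[OF op_bound_adj] Suc.prems that)
  then have "op_bound (J \<times> K) (J \<times> K) (block_diag ?y) (root (2 ^ n) (real (card J)) * (C * C))"
    using Suc.prems by (intro Suc.IH) auto
  also have "root (2 ^ n) (real (card J)) * (C * C) = (root (2 ^ Suc n) (real (card J)) * C)\<^sup>2"
    by (simp add: power_mult_distrib power2_eq_square[of C] real_root_mult_exp)
  finally have "op_bound (J \<times> K) (J \<times> K)
      (\<lambda>p q. \<Sum>r\<in>J \<times> I. adj (block_diag x r p) * block_diag x r q)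
      ((root (2 ^ Suc n) (real (card J)) * C)\<^sup>2)"
    by (rule op_bound_cong[THEN iffD1, rotated]) (auto simp: block_diag_adj_mult[OF finite_J])
  then show ?case by (rule op_bound_cstar_identity) (use Suc.prems in simp)
qed

lemma op_bound_block_diag:
  assumes finite_J: "finite J" and finite_K: "finite K" and C_nonneg: "0 \<le> C"
    and x_bound: "\<And>j. j \<in> J \<Longrightarrow> op_bound I K (x j :: 'i \<Rightarrow> 'i \<Rightarrow> 'a::cstar_algebra) C"
  shows "op_bound (J \<times> I) (J \<times> K) (block_diag x) C"
proof (cases "J = {}")
  case True
  then show ?thesis using C_nonneg by (simp add: op_bound_def hnorm_def)
next
  case False
  then have "(\<lambda>n. root n (real (card J))) \<longlonglongrightarrow> 1"
    using finite_J by (intro LIMSEQ_root_const) (simp add: card_gt_0_iff)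
  moreover have "strict_mono (\<lambda>n. 2 ^ n :: nat)" by (simp add: strict_mono_def)
  ultimately have "((\<lambda>n. root n (real (card J))) \<circ> (\<lambda>n. 2 ^ n)) \<longlonglongrightarrow> 1" by (rule LIMSEQ_subseq_LIMSEQ)
  then have "(\<lambda>n. root (2 ^ n) (real (card J))) \<longlonglongrightarrow> 1" by (simp add: o_def)
  then have lim: "(\<lambda>n. root (2 ^ n) (real (card J)) * C * h) \<longlonglongrightarrow> 1 * C * h" for h
    by (intro tendsto_intros)
  show ?thesis
  proof (rule op_boundI[OF C_nonneg])
    fix \<xi> :: "'b \<times> 'i \<Rightarrow> 'a"
    show "hnorm (J \<times> I) (mat_vec (J \<times> K) (block_diag x) \<xi>) \<le> C * hnorm (J \<times> K) \<xi>"
      using LIMSEQ_le_const[OF lim]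
        op_boundD[OF op_bound_block_diag_root[OF finite_J finite_K C_nonneg x_bound]]
      by simp
  qed
qed

lemma op_bound_column_operator:
  fixes e :: "'j \<Rightarrow> 'a::cstar_algebra"
  assumes "finite I" "norm (\<Sum>j\<in>J. adj (e j) * e j) \<le> C\<^sup>2" "0 \<le> C"
  shows "op_bound (J \<times> I) I (\<lambda>p i. if snd p = i then e (fst p) else 0) C"
proof (rule op_boundI)
  fix \<xi>
  let ?S = "\<Sum>j\<in>J. adj (e j) * e j" and ?v = "mat_vec I (\<lambda>p i. if snd p = i then e (fst p) else 0) \<xi>"
  have v_entry: "?v (j, i) = e j * \<xi> i" if "i \<in> I" for j i
    using assms(1) that by (simp add: if_distrib[of "\<lambda>a. a * _"] cong: if_cong)
  have "ip (J \<times> I) ?v ?v = (\<Sum>j\<in>J. \<Sum>i\<in>I. adj (e j * \<xi> i) * (e j * \<xi> i))"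
    unfolding sum.cartesian_product' by (intro sum.cong) (simp_all only: v_entry)
  also have "\<dots> = (\<Sum>i\<in>I. adj (\<xi> i) * ?S * \<xi> i)"
    by (simp add: adj_mult mult.assoc sum_distrib_left sum_distrib_right) (rule sum.swap)
  finally have ip_v: "ip (J \<times> I) ?v ?v = (\<Sum>i\<in>I. adj (\<xi> i) * ?S * \<xi> i)" .
  have "psd (\<Sum>i\<in>I. C\<^sup>2 *\<^sub>R (adj (\<xi> i) * \<xi> i) - adj (\<xi> i) * ?S * \<xi> i)"
    by (intro psd_sum conj_le_scaleR_adj_mult assms(2) adj_ip)
  then have "ip (J \<times> I) ?v ?v \<preceq> C\<^sup>2 *\<^sub>R ip I \<xi> \<xi>"
    unfolding ip_v by (simp add: sum_subtractf scaleR_sum_right)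
  then have "norm (ip (J \<times> I) ?v ?v) \<le> norm (C\<^sup>2 *\<^sub>R ip I \<xi> \<xi>)" by (rule norm_mono_psd[OF psd_ip])
  then have "(hnorm (J \<times> I) ?v)\<^sup>2 \<le> (C * hnorm I \<xi>)\<^sup>2"
    by (simp add: hnorm_power2 power_mult_distrib)
  then show "hnorm (J \<times> I) ?v \<le> C * hnorm I \<xi>"
    by (rule power2_le_imp_le) (simp add: assms(3))
qed (rule assms(3))

lemma op_bound_sum_compress:
  fixes x :: "'j \<Rightarrow> 'i \<Rightarrow> 'i \<Rightarrow> 'a::cstar_algebra"
  assumes finite_J: "finite J" and finite_I: "finite I" and finite_K: "finite K"
    and C_nonneg: "0 \<le> C"
    and x_bound: "\<And>j. j \<in> J \<Longrightarrow> op_bound I K (x j) C"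
  shows "op_bound I K (\<lambda>i k. \<Sum>j\<in>J. adj (e j) * x j i k * e j) (C * norm (\<Sum>j\<in>J. adj (e j) * e j))"
proof -
  let ?s = "sqrt (norm (\<Sum>j\<in>J. adj (e j) * e j))"
  define V where "V p i = (if snd p = i then e (fst p) else 0)" for p :: "'j \<times> 'i" and i
  have V_bound: "op_bound (J \<times> L) L V ?s" if "finite L" for L
    unfolding V_def by (rule op_bound_column_operator[OF that]) simp_all
  have entry: "(\<Sum>q\<in>J \<times> K. (\<Sum>p\<in>J \<times> I. adj (V p i) * block_diag x p q) * V q k)
      = (\<Sum>j\<in>J. adj (e j) * x j i k * e j)" if i_in: "i \<in> I" and k_in: "k \<in> K" for i k
  proof -
    have "(\<Sum>p\<in>J \<times> I. adj (V p i) * block_diag x p q) = adj (e (fst q)) * x (fst q) i (snd q)"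
      if "fst q \<in> J" for q
    proof -
      have "(\<Sum>p\<in>J \<times> I. adj (V p i) * block_diag x p q)
          = (\<Sum>j\<in>J. \<Sum>i'\<in>I.
              if i' = i then (if j = fst q then adj (e j) * x j i (snd q) else 0) else 0)"
        unfolding sum.cartesian_product' by (intro sum.cong) (auto simp: V_def block_diag_def)
      then show ?thesis using that i_in finite_I finite_J by simp
    qed
    then have "(\<Sum>q\<in>J \<times> K. (\<Sum>p\<in>J \<times> I. adj (V p i) * block_diag x p q) * V q k)
        = (\<Sum>j\<in>J. \<Sum>k'\<in>K. if k' = k then adj (e j) * x j i k * e j else 0)"
      unfolding sum.cartesian_product' by (intro sum.cong) (auto simp: V_def)
    then show ?thesis using k_in finite_K by simp
  qed
  have "op_bound I K
      (\<lambda>i k. \<Sum>q\<in>J \<times> K. (\<Sum>p\<in>J \<times> I. adj (V p i) * block_diag x p q) * V q k) (?s * C * ?s)"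
    by (rule op_bound_mult[OF op_bound_mult[OF op_bound_adj[OF V_bound[OF finite_I]]
          op_bound_block_diag[OF finite_J finite_K C_nonneg x_bound]] V_bound[OF finite_K]])
  then have "op_bound I K (\<lambda>i k. \<Sum>j\<in>J. adj (e j) * x j i k * e j) (?s * C * ?s)"
    by (rule op_bound_cong[THEN iffD1, rotated]) (simp add: entry)
  then show ?thesis by (simp add: mult.commute mult.left_commute)
qed

section \<open>Infinite matrices\<close>

lemma mnorm_n_le_iff: "mnorm_n n x \<le> C \<longleftrightarrow> op_bound {..<n} {..<n} x C"
proof -
  define S where "S = {hnorm {..<n} (mat_vec {..<n} x \<xi>) | \<xi>. hnorm {..<n} \<xi> \<le> 1}"
  have mnorm_n: "mnorm_n n x = Sup S"
    by (simp add: mnorm_n_def S_def hnorm_def)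
  have S_le_iff: "(\<forall>s\<in>S. s \<le> D) \<longleftrightarrow> op_bound {..<n} {..<n} x D" for D
    by (auto simp: S_def op_bound_iff_unit_ball)
  have "S \<noteq> {}" by (auto simp: S_def intro: exI[of _ "\<lambda>_. 0"])
  moreover have "bdd_above S"
    using S_le_iff op_bound_sum_norm[of "{..<n}" "{..<n}" x] unfolding bdd_above_def by blast
  ultimately show ?thesis unfolding mnorm_n S_le_iff[symmetric] by (rule cSup_le_iff)
qed

definition mat_bound :: "'a::cstar_algebra mat \<Rightarrow> real \<Rightarrow> bool" where
  "mat_bound x C \<longleftrightarrow> (\<forall>n. op_bound {..<n} {..<n} x C)"

lemma mat_boundD:
  assumes "mat_bound x C" "finite I" "finite J"
  shows "op_bound I J x C"
proof -
  obtain n where "I \<union> J \<subseteq> {..<n}" using assms(2,3) finite_nat_iff_bounded finite_Un by metis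
  then show ?thesis using assms(1) by (auto simp: mat_bound_def intro: op_bound_subset)
qed

lemma mat_boundI: "(\<And>n. op_bound {..<n} {..<n} x C) \<Longrightarrow> mat_bound x C"
  by (simp add: mat_bound_def)

lemma mat_bound_nonneg: "mat_bound x C \<Longrightarrow> 0 \<le> C"
  unfolding mat_bound_def using op_bound_nonneg by blast

lemma mat_bound_mono: "mat_bound x C \<Longrightarrow> C \<le> D \<Longrightarrow> mat_bound x D"
  unfolding mat_bound_def using op_bound_mono by blast

lemma mat_bound_add: "mat_bound x C \<Longrightarrow> mat_bound y D \<Longrightarrow> mat_bound (\<lambda>i j. x i j + y i j) (C + D)"
  by (simp add: mat_bound_def op_bound_add)

lemma mat_bound_diff: "mat_bound x C \<Longrightarrow> mat_bound y D \<Longrightarrow> mat_bound (\<lambda>i j. x i j - y i j) (C + D)"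
  by (simp add: mat_bound_def op_bound_diff)

lemma mat_bound_madj: "mat_bound x C \<Longrightarrow> mat_bound (madj x) C"
  by (simp add: mat_bound_def madj_def op_bound_adj)

lemma mat_bound_restrict:
  "mat_bound x C \<Longrightarrow> mat_bound (\<lambda>i j. if i \<in> P \<and> j \<in> Q then x i j else 0) C"
  by (intro mat_boundI op_bound_restrict) (auto intro: mat_boundD)

lemma mat_bound_trunc:
  assumes "op_bound {..<n} {..<n} x C" shows "mat_bound (trunc n x) C"
proof (rule mat_boundI)
  fix m
  have "op_bound {..<m} {..<m} (\<lambda>i j. if i \<in> {..<n} \<and> j \<in> {..<n} then x i j else 0) C"
    by (intro op_bound_restrict op_bound_subset[OF assms]) auto
  then show "op_bound {..<m} {..<m} (trunc n x) C" by (simp add: trunc_def)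
qed

lemma mat_bound_limit:
  assumes "\<And>n. mat_bound (x n) C" "\<And>i j. (\<lambda>n. x n i j) \<longlonglongrightarrow> y i j"
  shows "mat_bound y C"
  using assms(1)
  by (intro mat_boundI op_bound_limit[OF sequentially_bot _ assms(2)]) (simp add: mat_bound_def)

lemma mnorm_le_iff:
  assumes "mat_bound x D"
  shows "mnorm x \<le> C \<longleftrightarrow> mat_bound x C"
proof -
  have "bdd_above (range (\<lambda>n. mnorm_n n x))"
    using assms by (intro bdd_aboveI[of _ D]) (auto simp: mnorm_n_le_iff mat_bound_def)
  then show ?thesis
    unfolding mnorm_def by (simp add: cSUP_le_iff mnorm_n_le_iff mat_bound_def)
qed

lemma mnorm_nonneg: "mat_bound x D \<Longrightarrow> 0 \<le> mnorm x"
  using mnorm_le_iff mat_bound_nonneg by blast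

lemma stab_iff:
  "x \<in> stab B \<longleftrightarrow> (\<forall>i j. x i j \<in> B) \<and>
    (\<forall>e>0. \<forall>\<^sub>F m in sequentially. mat_bound (\<lambda>i j. x i j - trunc m x i j) e)"
proof -
  let ?y = "\<lambda>m i j. x i j - trunc m x i j"
  have tail_iff: "mat_bound (?y m) e \<longleftrightarrow> (\<forall>n\<ge>m. mnorm_n n (?y m) \<le> e)" for m e
  proof (intro iffI mat_boundI)
    fix n assume "\<forall>n\<ge>m. mnorm_n n (?y m) \<le> e"
    then have "op_bound {..<max m n} {..<max m n} (?y m) e" by (simp add: mnorm_n_le_iff)
    then show "op_bound {..<n} {..<n} (?y m) e" by (rule op_bound_subset) auto
  qed (simp add: mnorm_n_le_iff mat_boundD)
  have "(\<forall>e>0. \<exists>N. \<forall>m\<ge>N. \<forall>n\<ge>m. mnorm_n n (?y m) < e) \<longleftrightarrow>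
      (\<forall>e>0. \<exists>N. \<forall>m\<ge>N. \<forall>n\<ge>m. mnorm_n n (?y m) \<le> e)"
  proof (intro iffI allI impI)
    fix e :: real assume "\<forall>e>0. \<exists>N. \<forall>m\<ge>N. \<forall>n\<ge>m. mnorm_n n (?y m) \<le> e" "e > 0"
    then obtain N where "\<forall>m\<ge>N. \<forall>n\<ge>m. mnorm_n n (?y m) \<le> e / 2" using half_gt_zero by blast
    then show "\<exists>N. \<forall>m\<ge>N. \<forall>n\<ge>m. mnorm_n n (?y m) < e" using \<open>e > 0\<close> by (intro exI[of _ N]) force
  qed (meson less_imp_le)
  then show ?thesis by (simp add: stab_def tail_iff eventually_sequentially)
qed

lemma stab_tail:
  "x \<in> stab B \<Longrightarrow> e > 0 \<Longrightarrow> \<forall>\<^sub>F m in sequentially. mat_bound (\<lambda>i j. x i j - trunc m x i j) e"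
  by (simp add: stab_iff)

lemma stab_bounded:
  assumes "x \<in> stab B"
  obtains C where "mat_bound x C"
proof -
  obtain m where tail: "mat_bound (\<lambda>i j. x i j - trunc m x i j) 1"
    using eventually_happens'[OF sequentially_bot stab_tail[OF assms, of 1]] by auto
  have "mat_bound (trunc m x) (mnorm_n m x)"
    by (rule mat_bound_trunc) (simp add: mnorm_n_le_iff[symmetric])
  from mat_bound_add[OF tail this] show ?thesis by (intro that) simp
qed

lemma trunc_in_stab:
  assumes "\<And>i j. i < n \<Longrightarrow> j < n \<Longrightarrow> w i j \<in> B" "0 \<in> B"
  shows "trunc n w \<in> stab B"
proof -
  have "(\<lambda>i j. trunc n w i j - trunc m (trunc n w) i j) = (\<lambda>i j. 0)" if "m \<ge> n" for m
    using that by (auto simp: fun_eq_iff trunc_def)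
  then have "mat_bound (\<lambda>i j. trunc n w i j - trunc m (trunc n w) i j) e" if "m \<ge> n" "e > 0" for m e
    using that by (simp add: mat_bound_def op_bound_0)
  then have "\<forall>e>0. \<forall>\<^sub>F m in sequentially.
      mat_bound (\<lambda>i j. trunc n w i j - trunc m (trunc n w) i j) e"
    unfolding eventually_sequentially by blast
  then show ?thesis using assms by (auto simp: stab_iff trunc_def)
qed

lemma ex_pos_mult_le:
  fixes a e :: real
  assumes "a \<ge> 0" "e > 0"
  obtains d where "d > 0" "a * d \<le> e"
proof (rule that[of "e / (a + 1)"])
  show "e / (a + 1) > 0" "a * (e / (a + 1)) \<le> e"
    using assms by (simp_all add: field_simps add_nonneg_pos)
qed

definition product_summable :: "'a::cstar_algebra mat \<Rightarrow> 'a mat \<Rightarrow> bool" where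
  "product_summable u w \<longleftrightarrow> (\<forall>i j. summable (\<lambda>k. adj (u k i) * w k j))"

lemma mmult_madj_tendsto:
  assumes "product_summable u w"
  shows "(\<lambda>n. \<Sum>k<n. adj (u k i) * w k j) \<longlonglongrightarrow> mmult (madj u) w i j"
  using assms unfolding product_summable_def mmult_def madj_def
  by (simp add: summable_LIMSEQ suminf_eq_lim[symmetric])

lemma product_summable_swap:
  assumes "product_summable u w" shows "product_summable w u"
  unfolding product_summable_def
proof (intro allI)
  fix i j
  have "summable (\<lambda>k. adj (adj (u k j) * w k i))"
    using assms
    by (intro bounded_linear.summable[OF bounded_linear_adj]) (simp add: product_summable_def)
  then show "summable (\<lambda>k. adj (w k i) * u k j)" by (simp add: adj_mult)
qed

lemma product_summable_stab:
  assumes u_bound: "mat_bound u C" and w_stab: "w \<in> stab B"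
  shows "product_summable u w"
  unfolding product_summable_def summable_Cauchy
proof (intro allI impI)
  fix i j and e :: real assume "e > 0"
  then obtain d where d_small: "d > 0" "C * d \<le> e / 2"
    using ex_pos_mult_le[OF mat_bound_nonneg[OF u_bound], of "e / 2"] by auto
  obtain N where tail: "\<And>m. m \<ge> N \<Longrightarrow> mat_bound (\<lambda>i j. w i j - trunc m w i j) d"
    using stab_tail[OF w_stab d_small(1)] unfolding eventually_sequentially by blast
  have "norm (\<Sum>k\<in>{m..<n}. adj (u k i) * w k j) < e" if "m \<ge> N" for m n
  proof -
    have "hnorm {m..<n} (\<lambda>k. w k j) = hnorm {m..<n} (\<lambda>k. w k j - trunc m w k j)"
      by (rule hnorm_cong) (simp add: trunc_def)
    also have "\<dots> \<le> d"
      using op_bound_column[OF mat_boundD[OF tail[OF that], of "{m..<n}" "{j}"], of j] by simp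
    finally have "hnorm {m..<n} (\<lambda>k. u k i) * hnorm {m..<n} (\<lambda>k. w k j) \<le> C * d"
      using op_bound_column[OF mat_boundD[OF u_bound, of "{m..<n}" "{i}"], of i]
          mat_bound_nonneg[OF u_bound]
      by (intro mult_mono) auto
    then show ?thesis
      using Cauchy_Schwarz_ip[where I = "{m..<n}" and u = "\<lambda>k. u k i" and v = "\<lambda>k. w k j"]
        d_small(2) \<open>e > 0\<close>
      by linarith
  qed
  then show "\<exists>N. \<forall>m\<ge>N. \<forall>n. norm (\<Sum>k\<in>{m..<n}. adj (u k i) * w k j) < e" by blast
qed

lemma mat_bound_mmult_madj:
  assumes "product_summable u w" "mat_bound u C" "mat_bound w D"
  shows "mat_bound (mmult (madj u) w) (C * D)"
  by (rule mat_bound_limit[OF _ mmult_madj_tendsto[OF assms(1)]])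
    (intro mat_boundI op_bound_mult[OF op_bound_adj] mat_boundD[OF assms(2)]
        mat_boundD[OF assms(3)]; simp)

lemma mat_bound_mmult_madj_diff:
  assumes "product_summable u w" "product_summable u' w'"
    and u_bound: "mat_bound (\<lambda>k i. u k i - u' k i) d" "mat_bound u' C"
    and w_bound: "mat_bound (\<lambda>k j. w k j - w' k j) d'" "mat_bound w D"
  shows "mat_bound (\<lambda>i j. mmult (madj u) w i j - mmult (madj u') w' i j) (d * D + C * d')"
proof (rule mat_bound_limit)
  show "(\<lambda>n. (\<Sum>k<n. adj (u k i) * w k j) - (\<Sum>k<n. adj (u' k i) * w' k j))
      \<longlonglongrightarrow> mmult (madj u) w i j - mmult (madj u') w' i j" for i j
    by (intro tendsto_diff mmult_madj_tendsto assms)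
  show "mat_bound
      (\<lambda>i j. (\<Sum>k<n. adj (u k i) * w k j) - (\<Sum>k<n. adj (u' k i) * w' k j)) (d * D + C * d')" for n
  proof (rule mat_boundI)
    fix m
    have "op_bound {..<m} {..<m} (\<lambda>i j. (\<Sum>k<n. adj (u k i - u' k i) * w k j)
        + (\<Sum>k<n. adj (u' k i) * (w k j - w' k j))) (d * D + C * d')"
      by (intro op_bound_add op_bound_mult[OF op_bound_adj] mat_boundD[OF u_bound(1)]
          mat_boundD[OF u_bound(2)]
          mat_boundD[OF w_bound(1)] mat_boundD[OF w_bound(2)]; simp)
    then show "op_bound {..<m} {..<m}
        (\<lambda>i j. (\<Sum>k<n. adj (u k i) * w k j) - (\<Sum>k<n. adj (u' k i) * w' k j)) (d * D + C * d')"
      by (simp add: adj_diff algebra_simps sum_subtractf)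
  qed
qed

text \<open>With \<open>w\<close> the first \<open>m\<close> columns of \<open>c\<close>, the truncation of \<open>c\<^sup>* c\<close> is \<open>w\<^sup>* w\<close>.\<close>
lemma eventually_mmult_madj_self_tail:
  assumes stab: "c \<in> stab B" and "e > 0"
  defines "a \<equiv> mmult (madj c) c"
  shows "\<forall>\<^sub>F m in sequentially. mat_bound (\<lambda>i j. a i j - trunc m a i j) e"
proof -
  obtain C where c_bound: "mat_bound c C" using stab_bounded[OF stab] .
  have c_summable: "product_summable c c" by (rule product_summable_stab[OF c_bound stab])
  obtain d where d_small: "d > 0" "2 * C * d \<le> e"
    using ex_pos_mult_le[of "2 * C" e] mat_bound_nonneg[OF c_bound] \<open>e > 0\<close> by auto
  show ?thesis
    using stab_tail[OF stab d_small(1)]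
  proof eventually_elim
    case (elim m)
    define w where "w = (\<lambda>k i. if i < m then c k i else 0)"
    have "mat_bound w C"
      using mat_bound_restrict[OF c_bound, of UNIV "{..<m}"] by (simp add: w_def)
    moreover have "(\<lambda>k i. c k i - w k i) = (\<lambda>k i. if i \<in> {m..} then c k i - trunc m c k i else 0)"
      by (auto simp: w_def trunc_def fun_eq_iff)
    then have "mat_bound (\<lambda>k i. c k i - w k i) d"
      using mat_bound_restrict[OF elim, of UNIV "{m..}"] by simp
    moreover have "summable (\<lambda>k. adj (w k i) * w k j)" for i j
      using c_summable by (cases "i < m"; cases "j < m") (simp_all add: product_summable_def w_def)
    then have "product_summable w w" by (simp add: product_summable_def)
    moreover have "mmult (madj w) w = trunc m a"
      by (auto simp: a_def mmult_def madj_def trunc_def w_def fun_eq_iff)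
    ultimately have "mat_bound (\<lambda>i j. a i j - trunc m a i j) (d * C + C * d)"
      using mat_bound_mmult_madj_diff[OF c_summable, of w w d C d C] c_bound unfolding a_def by simp
    then show ?case by (rule mat_bound_mono) (use d_small(2) in \<open>simp add: algebra_simps\<close>)
  qed
qed

lemma cu_pos_subset_stab:
  assumes "closed B" "0 \<in> B" and add: "\<And>x y. x \<in> B \<Longrightarrow> y \<in> B \<Longrightarrow> x + y \<in> B"
    and mult: "\<And>x y. x \<in> B \<Longrightarrow> y \<in> B \<Longrightarrow> x * y \<in> B" and adj: "\<And>x. x \<in> B \<Longrightarrow> adj x \<in> B"
  shows "cu_pos B \<subseteq> stab B"
proof
  fix a assume "a \<in> cu_pos B"
  then obtain c where c_stab: "c \<in> stab B" and a_eq: "a = mmult (madj c) c"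
    by (auto simp: cu_pos_def)
  obtain C where "mat_bound c C" using stab_bounded[OF c_stab] .
  then have c_summable: "product_summable c c" by (rule product_summable_stab[OF _ c_stab])
  have "a i j \<in> B" for i j
  proof (rule closed_sequentially[OF \<open>closed B\<close>])
    show "(\<lambda>n. \<Sum>k<n. adj (c k i) * c k j) \<longlonglongrightarrow> a i j"
      unfolding a_eq by (rule mmult_madj_tendsto[OF c_summable])
    show "(\<Sum>k<n. adj (c k i) * c k j) \<in> B" for n
      using c_stab by (induction n) (auto simp: stab_iff intro!: add mult adj \<open>0 \<in> B\<close>)
  qed
  then show "a \<in> stab B"
    using eventually_mmult_madj_self_tail[OF c_stab] by (simp add: stab_iff a_eq)
qed

abbreviation mconj :: "'a::cstar_algebra mat \<Rightarrow> 'a mat \<Rightarrow> 'a mat" where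
  "mconj v b \<equiv> mmult (mmult (madj v) b) v"

lemma madj_madj [simp]: "madj (madj x) = (x :: 'a::cstar_algebra mat)"
  by (simp add: madj_def)

lemma mat_bound_mconj:
  assumes "v \<in> stab A" "mat_bound v C" "mat_bound b D"
  shows "mat_bound (mconj v b) (C * D * C)"
proof -
  have "mat_bound (madj (mmult (madj v) b)) (C * D)"
    by (intro mat_bound_madj mat_bound_mmult_madj assms
        product_summable_swap[OF product_summable_stab[OF assms(3,1)]])
  from mat_bound_mmult_madj[OF product_summable_stab[OF this assms(1)] this assms(2)] show ?thesis
    by simp
qed

lemma mat_bound_mconj_diff:
  assumes v_stab_bound: "v \<in> stab A" "mat_bound v C"
    and w_stab_bound: "w \<in> stab A'" "mat_bound w C'"
    and b_bound: "mat_bound b D" and diff_bound: "mat_bound (\<lambda>i j. v i j - w i j) d"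
  shows "mat_bound (\<lambda>i j. mconj v b i j - mconj w b i j) (d * D * C + C' * D * d)"
proof -
  have summable: "product_summable v b" "product_summable w b"
    by (rule product_summable_swap[OF product_summable_stab[OF b_bound]],
        rule v_stab_bound w_stab_bound)+
  have mult_bound: "mat_bound (madj (mmult (madj v) b)) (C * D)"
      "mat_bound (madj (mmult (madj w) b)) (C' * D)"
    by (intro mat_bound_madj mat_bound_mmult_madj summable v_stab_bound w_stab_bound b_bound)+
  have "mat_bound (\<lambda>i j. b i j - b i j) 0" by (simp add: mat_bound_def op_bound_0)
  from mat_bound_mmult_madj_diff[OF summable diff_bound w_stab_bound(2) this b_bound]
  have "mat_bound (madj (\<lambda>i j. mmult (madj v) b i j - mmult (madj w) b i j)) (d * D)"
    by (intro mat_bound_madj) simp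
  then have "mat_bound (\<lambda>i j. madj (mmult (madj v) b) i j - madj (mmult (madj w) b) i j) (d * D)"
    by (simp add: madj_def adj_diff)
  from mat_bound_mmult_madj_diff[OF product_summable_stab[OF mult_bound(1) v_stab_bound(1)]
      product_summable_stab[OF mult_bound(2) w_stab_bound(1)] this mult_bound(2) diff_bound
          v_stab_bound(2)]
  show ?thesis by simp
qed

lemma eventually_mconj_trunc_near:
  assumes v_stab: "v \<in> stab A" and b_bound: "mat_bound b D" and "e > 0"
  shows "\<forall>\<^sub>F n in sequentially. mat_bound (\<lambda>i j. mconj (trunc n v) b i j - mconj v b i j) e"
proof -
  obtain C where v_bound: "mat_bound v C" using stab_bounded[OF v_stab] .
  obtain d where d_small: "d > 0" "2 * C * D * d \<le> e"
    using ex_pos_mult_le[of "2 * C * D" e] mat_bound_nonneg[OF v_bound] mat_bound_nonneg[OF b_bound]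
      \<open>e > 0\<close>
    by auto
  show ?thesis
    using stab_tail[OF v_stab d_small(1)]
  proof eventually_elim
    case (elim n)
    have trunc_bound: "mat_bound (trunc n v) C"
      by (rule mat_bound_trunc[OF mat_boundD[OF v_bound]]) simp_all
    have "trunc n v \<in> stab UNIV" by (rule trunc_in_stab) simp_all
    moreover have "mat_bound (\<lambda>i j. trunc n v i j - v i j) d"
      using elim op_bound_minus[of _ _ "\<lambda>i j. v i j - trunc n v i j" d] by (simp add: mat_bound_def)
    ultimately have
      "mat_bound (\<lambda>i j. mconj (trunc n v) b i j - mconj v b i j) (d * D * C + C * D * d)"
      by (intro mat_bound_mconj_diff[OF _ trunc_bound v_stab v_bound b_bound])
    then show ?case by (rule mat_bound_mono) (use d_small(2) in \<open>simp add: algebra_simps\<close>)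
  qed
qed

definition sandwich ::
    "'k set \<Rightarrow> ('k \<Rightarrow> 'i \<Rightarrow> 'a::cstar_algebra) \<Rightarrow> ('k \<Rightarrow> 'k \<Rightarrow> 'a) \<Rightarrow> 'i \<Rightarrow> 'i \<Rightarrow> 'a" where
  "sandwich K v b i j = (\<Sum>k\<in>K. (\<Sum>l\<in>K. adj (v l i) * b l k) * v k j)"

lemma op_bound_sandwich_diff:
  assumes x_bound: "op_bound K I x C" and y_bound: "op_bound K I y C'"
    and b_bound: "op_bound K K b D"
    and diff_bound: "op_bound K I (\<lambda>k i. x k i - y k i) d"
  shows "op_bound I I (\<lambda>i j. sandwich K x b i j - sandwich K y b i j) (d * D * C + C' * D * d)"
proof -
  have "op_bound I I (\<lambda>i j. (\<Sum>k\<in>K. (\<Sum>l\<in>K. adj (x l i - y l i) * b l k) * x k j)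
      + (\<Sum>k\<in>K. (\<Sum>l\<in>K. adj (y l i) * b l k) * (x k j - y k j))) (d * D * C + C' * D * d)"
    by (intro op_bound_add op_bound_mult op_bound_adj[of K I] x_bound y_bound b_bound diff_bound)
  then show ?thesis
    unfolding sandwich_def
    by (simp add: adj_diff left_diff_distrib right_diff_distrib sum_subtractf)
qed

lemma mmult_eq_sum:
  assumes "\<And>k. k \<ge> n \<Longrightarrow> x i k * y k j = 0"
  shows "mmult x y i j = (\<Sum>k<n. x i k * y k j)"
  using sums_finite[of "{..<n}" "\<lambda>k. x i k * y k j"] assms
  unfolding mmult_def sums_def by (intro limI) auto

lemma mconj_trunc: "mconj (trunc n v) b = trunc n (sandwich {..<n} v b)"
proof (intro ext)
  fix i j
  have mmult_left: "mmult (madj (trunc n v)) b i k = (if i < n then \<Sum>l<n. adj (v l i) * b l k else 0)"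
      for k
    by (subst mmult_eq_sum[of n]) (auto simp: madj_def trunc_def)
  have "mconj (trunc n v) b i j = (\<Sum>k<n. mmult (madj (trunc n v)) b i k * trunc n v k j)"
    by (rule mmult_eq_sum) (simp add: trunc_def)
  also have "\<dots> = trunc n (sandwich {..<n} v b) i j"
    unfolding mmult_left by (auto simp: trunc_def sandwich_def)
  finally show "mconj (trunc n v) b i j = trunc n (sandwich {..<n} v b) i j" .
qed

lemma cuntz_le_iff:
  assumes a_bound: "mat_bound a A" and b_bound: "mat_bound b D"
  shows "cuntz_le B a b \<longleftrightarrow> (\<forall>e>0. \<exists>v\<in>stab B. mat_bound (\<lambda>i j. mconj v b i j - a i j) e)"
proof -
  have bounded: "\<exists>C. mat_bound (\<lambda>i j. mconj v b i j - a i j) C" if "v \<in> stab B" for v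
    using stab_bounded[OF that] mat_bound_diff[OF mat_bound_mconj[OF that _ b_bound] a_bound]
    by metis
  show ?thesis
  proof (intro iffI allI impI)
    fix e :: real assume "cuntz_le B a b" "e > 0"
    then obtain v where v_approx: "\<And>k. v k \<in> stab B"
        and lim: "(\<lambda>k. mnorm (\<lambda>i j. mconj (v k) b i j - a i j)) \<longlonglongrightarrow> 0"
      unfolding cuntz_le_def by blast
    obtain k where small: "mnorm (\<lambda>i j. mconj (v k) b i j - a i j) < e"
      using eventually_happens'[OF sequentially_bot order_tendstoD(2)[OF lim \<open>e > 0\<close>]] by blast
    obtain C where "mat_bound (\<lambda>i j. mconj (v k) b i j - a i j) C" using bounded[OF v_approx]
      by blast
    from mnorm_le_iff[OF this] less_imp_le[OF small]
    have "mat_bound (\<lambda>i j. mconj (v k) b i j - a i j) e"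
      by (rule iffD1)
    then show "\<exists>v\<in>stab B. mat_bound (\<lambda>i j. mconj v b i j - a i j) e" using v_approx by blast
  next
    assume approx: "\<forall>e>0. \<exists>v\<in>stab B. mat_bound (\<lambda>i j. mconj v b i j - a i j) e"
    have "\<exists>v\<in>stab B. mat_bound (\<lambda>i j. mconj v b i j - a i j) (inverse (real (Suc k)))" for k
      using approx by simp
    then obtain v where v_approx: "\<And>k. v k \<in> stab B"
        "\<And>k. mat_bound (\<lambda>i j. mconj (v k) b i j - a i j) (inverse (real (Suc k)))"
      by metis
    have "(\<lambda>k. mnorm (\<lambda>i j. mconj (v k) b i j - a i j)) \<longlonglongrightarrow> 0"
    proof (rule tendsto_sandwich[OF _ _ tendsto_const LIMSEQ_inverse_real_of_nat])
      show "\<forall>\<^sub>F k in sequentially. 0 \<le> mnorm (\<lambda>i j. mconj (v k) b i j - a i j)"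
        using mnorm_nonneg[OF v_approx(2)] by simp
      show "\<forall>\<^sub>F k in sequentially. mnorm (\<lambda>i j. mconj (v k) b i j - a i j) \<le> inverse (real (Suc k))"
        using mnorm_le_iff[OF v_approx(2)] v_approx(2) by simp
    qed
    then show "cuntz_le B a b" using v_approx(1) by (auto simp: cuntz_le_def)
  qed
qed

section \<open>Actions of compact groups\<close>

lemma psd_cstar_aut:
  assumes "cstar_aut h" "psd x" shows "psd (h x)"
proof -
  obtain k where "adj k = k" "x = k * k" using assms(2) by (auto simp: psd_def)
  then have "adj (h k) = h k" "h x = h k * h k"
    using assms(1) unfolding cstar_aut_def by metis+
  then show ?thesis by (auto simp: psd_def)
qed

lemma cstar_aut_one:
  assumes "cstar_aut h" shows "h 1 = 1"
proof -
  obtain x where "h x = 1" using assms unfolding cstar_aut_def by (metis bij_pointE)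
  then have "h 1 = h 1 * h x" by simp
  also have "\<dots> = h (1 * x)" using assms unfolding cstar_aut_def by metis
  finally show ?thesis using \<open>h x = 1\<close> by simp
qed

lemma cstar_aut_linear:
  assumes "cstar_aut h" shows "linear h"
proof (rule linearI)
  show "h (x + y) = h x + h y" for x y using assms unfolding cstar_aut_def by metis
  show "h (r *\<^sub>R x) = r *\<^sub>R h x" for r x using assms unfolding cstar_aut_def
    by (metis cscale_of_real)
qed

lemma cstar_aut_norm_le:
  assumes "cstar_aut h" shows "norm (h x) \<le> norm x"
proof -
  let ?t = "(norm x)\<^sup>2"
  interpret linear h by (rule cstar_aut_linear[OF assms])
  have "adj x * x \<preceq> ?t *\<^sub>R 1"
    by (rule self_adjoint_le_scalar) (auto simp: adj_mult norm_adj_mult_self)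
  then have "psd (h (?t *\<^sub>R 1 - adj x * x))" by (rule psd_cstar_aut[OF assms])
  also have "h (?t *\<^sub>R 1 - adj x * x) = ?t *\<^sub>R 1 - adj (h x) * h x"
    using assms by (simp add: diff scaleR cstar_aut_one) (metis cstar_aut_def)
  finally have "norm (adj (h x) * h x) \<le> ?t" by (rule norm_le_of_le_scalar[OF psd_adj_mult]) simp
  then show ?thesis by (simp add: norm_adj_mult_self)
qed

lemma uniform_limit_sum:
  fixes f :: "'j \<Rightarrow> 'n \<Rightarrow> 'x \<Rightarrow> 'a::real_normed_vector"
  assumes "\<And>j. j \<in> J \<Longrightarrow> uniform_limit S (f j) (l j) F"
  shows "uniform_limit S (\<lambda>n x. \<Sum>j\<in>J. f j n x) (\<lambda>x. \<Sum>j\<in>J. l j x) F"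
  using assms by (induction J rule: infinite_finite_induct) (auto intro!: uniform_limit_intros)

locale compact_action =
  fixes \<alpha> :: "'g::{t2_space,group_add} \<Rightarrow> 'a::cstar_algebra \<Rightarrow> 'a"
  assumes compact_group: "compact_group TYPE('g)" and action: "cstar_action \<alpha>"
begin

lemma compact_UNIV: "compact (UNIV :: 'g set)"
  using compact_group by (simp add: compact_group_def)

lemma continuous_translate:
  assumes "continuous_on UNIV (q :: 'g \<Rightarrow> 'b::topological_space)"
  shows "continuous_on UNIV (\<lambda>h. q (g + h))"
proof -
  have "continuous_on UNIV (\<lambda>p::'g \<times> 'g. fst p + snd p)"
    using compact_group by (simp add: compact_group_def)
  then have "continuous_on UNIV (\<lambda>h::'g. fst (g, h) + snd (g, h))"
    by (rule continuous_on_compose2) (auto intro: continuous_intros)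
  then have "continuous_on UNIV (\<lambda>h::'g. g + h)" by simp
  then show ?thesis by (rule continuous_on_compose2[OF assms]) simp
qed

lemma act_aut: "cstar_aut (\<alpha> g)"
  using action by (simp add: cstar_action_def)

lemma act_add: "\<alpha> g (x + y) = \<alpha> g x + \<alpha> g y"
  and act_mult: "\<alpha> g (x * y) = \<alpha> g x * \<alpha> g y"
  and act_adj: "\<alpha> g (adj x) = adj (\<alpha> g x)"
  using act_aut[of g] by (auto simp: cstar_aut_def)

lemma act_act: "\<alpha> g (\<alpha> h x) = \<alpha> (g + h) x"
  using action by (simp add: cstar_action_def)

lemma act_0 [simp]: "\<alpha> 0 x = x"
  using action by (simp add: cstar_action_def)

lemma linear_act: "linear (\<alpha> g)"
  by (rule cstar_aut_linear[OF act_aut])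

lemma act_diff: "\<alpha> g (x - y) = \<alpha> g x - \<alpha> g y"
  by (rule linear_diff[OF linear_act])

lemma act_sum: "\<alpha> g (sum f S) = (\<Sum>i\<in>S. \<alpha> g (f i))"
  by (rule linear_sum[OF linear_act])

lemma act_zero [simp]: "\<alpha> g 0 = 0"
  by (rule linear_0[OF linear_act])

lemma norm_act [simp]: "norm (\<alpha> g x) = norm x"
proof (rule antisym)
  show "norm (\<alpha> g x) \<le> norm x" by (rule cstar_aut_norm_le[OF act_aut])
  show "norm x \<le> norm (\<alpha> g x)"
    using cstar_aut_norm_le[OF act_aut, of "- g" "\<alpha> g x"] by (simp add: act_act)
qed

lemma bounded_linear_act: "bounded_linear (\<alpha> g)"
  by (rule bounded_linear_intro[where K=1]) (auto simp: act_add linear_cmul[OF linear_act])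

lemma continuous_act: "continuous_on UNIV (\<lambda>g. \<alpha> g x)"
  using action by (simp add: cstar_action_def)

lemma closed_fixed_points: "closed (fixed_points \<alpha>)"
proof -
  have "closed {x. \<alpha> g x = x}" for g
    by (intro closed_Collect_eq bounded_linear.continuous_on[OF bounded_linear_act]
        continuous_intros)
  moreover have "fixed_points \<alpha> = (\<Inter>g. {x. \<alpha> g x = x})" by (auto simp: fixed_points_def)
  ultimately show ?thesis by auto
qed

lemma cu_pos_fixed_points_subset_stab: "cu_pos (fixed_points \<alpha>) \<subseteq> stab (fixed_points \<alpha>)"
  by (rule cu_pos_subset_stab[OF closed_fixed_points])
    (auto simp: fixed_points_def act_add act_mult act_adj)

lemma hnorm_act: "hnorm I (\<lambda>i. \<alpha> g (u i)) = hnorm I u"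
proof -
  have "ip I (\<lambda>i. \<alpha> g (u i)) (\<lambda>i. \<alpha> g (u i)) = \<alpha> g (ip I u u)"
    by (simp add: act_sum act_mult act_adj)
  then show ?thesis by (simp add: hnorm_def)
qed

lemma op_bound_act:
  assumes "op_bound I J x C" shows "op_bound I J (\<lambda>i j. \<alpha> g (x i j)) C"
proof (rule op_boundI)
  show "0 \<le> C" using assms by (rule op_bound_nonneg)
  fix \<xi> :: "'c \<Rightarrow> 'a"
  have "mat_vec J (\<lambda>i j. \<alpha> g (x i j)) \<xi> i = \<alpha> g (mat_vec J x (\<lambda>j. \<alpha> (- g) (\<xi> j)) i)" for i
    by (simp add: act_sum act_mult act_act)
  then show "hnorm I (mat_vec J (\<lambda>i j. \<alpha> g (x i j)) \<xi>) \<le> C * hnorm J \<xi>"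
    using op_boundD[OF assms, of "\<lambda>j. \<alpha> (- g) (\<xi> j)"] by (simp only: hnorm_act)
qed

text \<open>The sequences in \<open>\<ell>\<^sup>\<infinity>\<^sub>\<alpha>\<close>, apart from boundedness.\<close>
definition equicont :: "(nat \<Rightarrow> 'a) \<Rightarrow> bool" where
  "equicont x \<longleftrightarrow> (\<forall>g0. uniform_limit UNIV (\<lambda>g n. \<alpha> g (x n)) (\<lambda>n. \<alpha> g0 (x n)) (nhds g0))"

lemma equicont_sum: "(\<And>j. j \<in> J \<Longrightarrow> equicont (x j)) \<Longrightarrow> equicont (\<lambda>n. \<Sum>j\<in>J. x j n)"
  by (simp add: equicont_def act_sum uniform_limit_sum)

lemma equicont_mult_const:
  assumes "equicont x" "bounded (range x)"
  shows "equicont (\<lambda>n. x n * c)"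
  unfolding equicont_def act_mult
proof (intro allI uniform_lim_mult)
  fix g
  show "uniform_limit UNIV (\<lambda>g n. \<alpha> g (x n)) (\<lambda>n. \<alpha> g (x n)) (nhds g)"
    using assms(1) by (simp add: equicont_def)
  have "((\<lambda>g. \<alpha> g c) \<longlongrightarrow> \<alpha> g c) (nhds g)"
    using continuous_act[of c] tendsto_at_iff_tendsto_nhds[of "\<lambda>g. \<alpha> g c" g]
    by (simp add: continuous_on_eq_continuous_at isCont_def)
  then show "uniform_limit UNIV (\<lambda>g n. \<alpha> g c) (\<lambda>n. \<alpha> g c) (nhds g)"
    by (simp add: uniform_limit_iff tendsto_iff)
  show "bounded (range (\<lambda>n. \<alpha> g (x n)))" using assms(2) by (simp add: bounded_iff)
qed simp

definition almost_fixed :: "'i set \<Rightarrow> 'j set \<Rightarrow> ('i \<Rightarrow> 'j \<Rightarrow> 'a) \<Rightarrow> real \<Rightarrow> bool" where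
  "almost_fixed I J w C \<longleftrightarrow> (\<forall>g. op_bound I J (\<lambda>i j. \<alpha> g (w i j) - w i j) C)"

lemma almost_fixed_mono: "almost_fixed I J w C \<Longrightarrow> C \<le> D \<Longrightarrow> almost_fixed I J w D"
  by (simp add: almost_fixed_def op_bound_mono[where C = C])

lemma eventually_almost_fixed:
  assumes finite_J: "finite J" and w_equicont: "\<And>i j. equicont (\<lambda>n. w n i j)"
    and w_bound: "\<And>g. \<forall>\<^sub>F n in sequentially. op_bound I J (\<lambda>i j. \<alpha> g (w n i j) - w n i j) C"
    and e_pos: "e > 0"
  shows "\<forall>\<^sub>F n in sequentially. almost_fixed I J (w n) (C + e)"
proof -
  define d where "d g0 g n = (\<Sum>i\<in>I. \<Sum>j\<in>J. norm (\<alpha> g (w n i j) - \<alpha> g0 (w n i j)))" for g0 g n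
  have "uniform_limit UNIV (d g0)
      (\<lambda>n. \<Sum>i\<in>I. \<Sum>j\<in>J. norm (\<alpha> g0 (w n i j) - \<alpha> g0 (w n i j))) (nhds g0)" for g0
    using w_equicont unfolding equicont_def d_def
    by (intro uniform_limit_sum uniform_limit_intros) auto
  then have lim: "uniform_limit UNIV (d g0) (\<lambda>n. 0) (nhds g0)" for g0 by simp
  have "\<forall>\<^sub>F g in nhds g0. \<forall>n. d g0 g n < e" for g0
    using uniform_limitD[OF lim e_pos, of g0] by eventually_elim (simp add: abs_less_iff)
  then obtain U where U_cover: "\<And>g0. open (U g0)" "\<And>g0. g0 \<in> U g0"
      "\<And>g0 g n. g \<in> U g0 \<Longrightarrow> d g0 g n < e"
    unfolding eventually_nhds by metis
  have "UNIV \<subseteq> (\<Union>g. U g)" using U_cover(2) by blast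
  with U_cover(1) obtain F where F_cover: "finite F" "UNIV \<subseteq> (\<Union>g\<in>F. U g)"
    by (rule compactE_image[OF compact_UNIV])
  have "\<forall>\<^sub>F n in sequentially. \<forall>g\<in>F. op_bound I J (\<lambda>i j. \<alpha> g (w n i j) - w n i j) C"
    by (intro eventually_ball_finite ballI F_cover w_bound)
  then show ?thesis
  proof eventually_elim
    case (elim n)
    show ?case
      unfolding almost_fixed_def
    proof
      fix g
      obtain g0 where g0_near: "g0 \<in> F" "g \<in> U g0" using F_cover(2) by blast
      have "op_bound I J (\<lambda>i j. \<alpha> g (w n i j) - \<alpha> g0 (w n i j)) e"
        using op_bound_mono[OF op_bound_sum_norm[OF finite_J]
            less_imp_le[OF U_cover(3)[OF g0_near(2), unfolded d_def]]] .
      from op_bound_add[OF bspec[OF elim g0_near(1)] this]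
      show "op_bound I J (\<lambda>i j. \<alpha> g (w n i j) - w n i j) (C + e)" by simp
    qed
  qed
qed

end

section \<open>Partitions of unity\<close>

definition partition_of_unity :: "'j set \<Rightarrow> ('j \<Rightarrow> 'g::topological_space \<Rightarrow> real) \<Rightarrow> bool" where
  "partition_of_unity J q \<longleftrightarrow> finite J \<and> (\<forall>j\<in>J. continuous_on UNIV (q j)) \<and> (\<forall>j\<in>J. \<forall>h. 0 \<le> q j h)
     \<and> (\<forall>h. (\<Sum>j\<in>J. q j h) = 1)"

lemma partition_of_unityD:
  assumes "partition_of_unity J q"
  shows "finite J" "\<And>j. j \<in> J \<Longrightarrow> continuous_on UNIV (q j)" "\<And>j h. j \<in> J \<Longrightarrow> 0 \<le> q j h"
    "\<And>h. (\<Sum>j\<in>J. q j h) = 1"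
  using assms by (auto simp: partition_of_unity_def)

lemma partition_of_unity_Times:
  assumes "partition_of_unity J q" "partition_of_unity K r"
  shows "partition_of_unity (J \<times> K) (\<lambda>p h. q (fst p) h * r (snd p) h)"
  using assms
  by (auto simp: partition_of_unity_def sum.cartesian_product' sum_product[symmetric]
      intro!: continuous_intros)

lemma partition_of_unity_exists:
  assumes "compact (UNIV :: 'g::topological_space set)"
    and r_continuous: "\<And>g. continuous_on UNIV (r g :: 'g \<Rightarrow> real)" "\<And>g. r g g < d"
  obtains F p where "partition_of_unity F p" "\<And>g h. p g h \<noteq> 0 \<Longrightarrow> r g h < d"
proof -
  have "open {h. r g h < d}" for g by (intro open_Collect_less r_continuous continuous_intros)
  moreover have "UNIV \<subseteq> (\<Union>g. {h. r g h < d})" using r_continuous(2) by blast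
  ultimately obtain F where F_cover: "finite F" "UNIV \<subseteq> (\<Union>g\<in>F. {h. r g h < d})"
    by (rule compactE_image[OF assms(1), where f = "\<lambda>g. {h. r g h < d}"])
  define t where "t = (\<lambda>g h. max 0 (d - r g h))"
  define S where "S = (\<lambda>h. \<Sum>g\<in>F. t g h)"
  have S_pos: "S h > 0" for h
  proof -
    obtain g where g_near: "g \<in> F" "r g h < d" using F_cover(2) by blast
    then have "0 < t g h" by (simp add: t_def)
    also have "\<dots> \<le> S h" unfolding S_def
      by (rule member_le_sum) (use F_cover g_near in \<open>auto simp: t_def\<close>)
    finally show ?thesis .
  qed
  have t_continuous: "continuous_on UNIV (t g)" for g unfolding t_def
    by (intro continuous_intros r_continuous)
  have "continuous_on UNIV S" unfolding S_def by (intro continuous_intros t_continuous)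
  then have "continuous_on UNIV (\<lambda>h. t g h / S h)" for g
    using S_pos by (intro continuous_on_divide t_continuous) (auto simp: less_imp_neq[symmetric])
  moreover have "0 \<le> t g h / S h" for g h using S_pos[of h] by (simp add: t_def)
  moreover have "(\<Sum>g\<in>F. t g h / S h) = 1" for h
    using S_pos[of h] by (simp add: sum_divide_distrib[symmetric] S_def)
  ultimately have "partition_of_unity F (\<lambda>g h. t g h / S h)"
    using F_cover(1) by (simp add: partition_of_unity_def)
  then show ?thesis by (rule that) (auto simp: t_def max_def split: if_splits)
qed

lemma (in compact_action) partition_of_unity_translate:
  fixes q :: "'j \<Rightarrow> 'g \<Rightarrow> real"
  assumes "partition_of_unity J q"
  shows "partition_of_unity J (\<lambda>j h. q j (g + h))"
  using assms by (simp add: partition_of_unity_def continuous_translate)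

section \<open>Sequences modulo null sequences\<close>

definition asymp_eq :: "(nat \<Rightarrow> 'a::real_normed_algebra) \<Rightarrow> (nat \<Rightarrow> 'a) \<Rightarrow> bool" where
  "asymp_eq x y \<longleftrightarrow> Bseq x \<and> Bseq y \<and> (\<lambda>n. x n - y n) \<longlonglongrightarrow> 0"

lemma asymp_eq_refl: "Bseq x \<Longrightarrow> asymp_eq x x"
  by (simp add: asymp_eq_def)

lemma asymp_eq_const: "asymp_eq (\<lambda>n. c) (\<lambda>n. c)"
  by (simp add: asymp_eq_def)

lemma asymp_eq_sym: "asymp_eq x y \<Longrightarrow> asymp_eq y x"
  unfolding asymp_eq_def using tendsto_minus[of "\<lambda>n. x n - y n" 0 sequentially] by simp

lemma asymp_eq_trans [trans]: "asymp_eq x y \<Longrightarrow> asymp_eq y z \<Longrightarrow> asymp_eq x z"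
  unfolding asymp_eq_def
  using tendsto_add[of "\<lambda>n. x n - y n" 0 sequentially "\<lambda>n. y n - z n" 0] by simp

lemma Bseq_add_Bseq:
  fixes x y :: "nat \<Rightarrow> 'a::real_normed_vector"
  shows "Bseq x \<Longrightarrow> Bseq y \<Longrightarrow> Bseq (\<lambda>n. x n + y n)"
  unfolding Bseq_eq_bounded by (rule bounded_plus_comp)

lemma Bseq_mult_Bseq:
  fixes x y :: "nat \<Rightarrow> 'a::real_normed_algebra"
  assumes "Bseq x" "Bseq y"
  shows "Bseq (\<lambda>n. x n * y n)"
proof -
  obtain K L where x_bound: "K > 0" "\<And>n. norm (x n) \<le> K" and y_bound: "\<And>n. norm (y n) \<le> L"
    using assms unfolding Bseq_def by blast
  have "norm (x n * y n) \<le> K * L" for n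
    using x_bound y_bound by (intro order_trans[OF norm_mult_ineq] mult_mono) auto
  then show ?thesis by (rule BseqI')
qed

lemma asymp_eq_add:
  assumes "asymp_eq x y" "asymp_eq u v" shows "asymp_eq (\<lambda>n. x n + u n) (\<lambda>n. y n + v n)"
proof -
  have "(\<lambda>n. (x n + u n) - (y n + v n)) \<longlonglongrightarrow> 0"
    using tendsto_add[of "\<lambda>n. x n - y n" 0 sequentially "\<lambda>n. u n - v n" 0] assms
    by (simp add: asymp_eq_def algebra_simps)
  then show ?thesis using assms by (simp add: asymp_eq_def Bseq_add_Bseq)
qed

lemma asymp_eq_minus: "asymp_eq x y \<Longrightarrow> asymp_eq (\<lambda>n. - x n) (\<lambda>n. - y n)"
  unfolding asymp_eq_def
  using tendsto_minus[of "\<lambda>n. x n - y n" 0 sequentially] by (simp add: Bseq_minus_iff)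

lemma asymp_eq_diff: "asymp_eq x y \<Longrightarrow> asymp_eq u v \<Longrightarrow> asymp_eq (\<lambda>n. x n - u n) (\<lambda>n. y n - v n)"
  using asymp_eq_add[OF _ asymp_eq_minus, of x y u v] by simp

lemma asymp_eq_mult:
  assumes "asymp_eq x y" "asymp_eq u v" shows "asymp_eq (\<lambda>n. x n * u n) (\<lambda>n. y n * v n)"
proof -
  have "(\<lambda>n. x n * (u n - v n)) \<longlonglongrightarrow> 0"
    using assms bounded_bilinear.Bfun_prod_Zfun[OF bounded_bilinear_mult,
        of x sequentially "\<lambda>n. u n - v n"]
    by (simp add: asymp_eq_def tendsto_Zfun_iff)
  moreover have "(\<lambda>n. (x n - y n) * v n) \<longlonglongrightarrow> 0"
    using assms bounded_bilinear.Zfun_prod_Bfun[OF bounded_bilinear_mult,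
        of "\<lambda>n. x n - y n" sequentially v]
    by (simp add: asymp_eq_def tendsto_Zfun_iff)
  ultimately have "(\<lambda>n. x n * (u n - v n) + (x n - y n) * v n) \<longlonglongrightarrow> 0" using tendsto_add by fastforce
  then show ?thesis using assms by (simp add: asymp_eq_def Bseq_mult_Bseq algebra_simps)
qed

lemma asymp_eq_sum:
  "(\<And>j. j \<in> J \<Longrightarrow> asymp_eq (x j) (y j)) \<Longrightarrow> asymp_eq (\<lambda>n. \<Sum>j\<in>J. x j n) (\<lambda>n. \<Sum>j\<in>J. y j n)"
  by (induction J rule: infinite_finite_induct) (auto intro: asymp_eq_add simp: asymp_eq_const)

section \<open>The Rokhlin property\<close>

locale rokhlin_map = compact_action \<alpha>
  for \<alpha> :: "'g::{t2_space,group_add} \<Rightarrow> 'a::cstar_algebra \<Rightarrow> 'a" +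
  fixes \<phi> :: "('g \<Rightarrow> complex) \<Rightarrow> nat \<Rightarrow> 'a"
  assumes phi_bounded: "continuous_on UNIV f \<Longrightarrow> bounded (range (\<phi> f))"
    and phi_equicontinuous: "continuous_on UNIV f \<Longrightarrow> e > 0 \<Longrightarrow>
      \<forall>\<^sub>F g in nhds g0. \<forall>n. norm (\<alpha> g (\<phi> f n) - \<alpha> g0 (\<phi> f n)) \<le> e"
    and phi_central: "continuous_on UNIV f \<Longrightarrow> (\<lambda>n. \<phi> f n * a - a * \<phi> f n) \<longlonglongrightarrow> 0"
    and phi_equivariant: "continuous_on UNIV f \<Longrightarrow> (\<lambda>n. \<phi> (\<lambda>h. f (- g + h)) n - \<alpha> g (\<phi> f n)) \<longlonglongrightarrow> 0"
    and phi_star: "continuous_on UNIV f \<Longrightarrow> (\<lambda>n. \<phi> (\<lambda>h. cnj (f h)) n - adj (\<phi> f n)) \<longlonglongrightarrow> 0"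
    and phi_homogeneous: "continuous_on UNIV f \<Longrightarrow> (\<lambda>n. \<phi> (\<lambda>h. c * f h) n - cscale c (\<phi> f n)) \<longlonglongrightarrow> 0"
    and phi_additive: "continuous_on UNIV f \<Longrightarrow> continuous_on UNIV f' \<Longrightarrow>
      (\<lambda>n. \<phi> (\<lambda>h. f h + f' h) n - (\<phi> f n + \<phi> f' n)) \<longlonglongrightarrow> 0"
    and phi_multiplicative: "continuous_on UNIV f \<Longrightarrow> continuous_on UNIV f' \<Longrightarrow>
      (\<lambda>n. \<phi> (\<lambda>h. f h * f' h) n - \<phi> f n * \<phi> f' n) \<longlonglongrightarrow> 0"
    and phi_unital: "(\<lambda>n. \<phi> (\<lambda>h. 1) n - 1) \<longlonglongrightarrow> 0"

lemma rokhlin_map_exists: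
  assumes "compact_group TYPE('g::{t2_space,group_add})" "cstar_action \<alpha>" "rokhlin \<alpha>"
  obtains \<phi> where "rokhlin_map (\<alpha> :: 'g \<Rightarrow> 'a::cstar_algebra \<Rightarrow> 'a) \<phi>"
  using assms(3) unfolding rokhlin_def
proof (elim exE conjE)
  fix \<phi> :: "('g \<Rightarrow> complex) \<Rightarrow> nat \<Rightarrow> 'a"
  assume phi: "\<forall>f. continuous_on UNIV f \<longrightarrow>
        bounded (range (\<phi> f))
        \<and> (\<forall>g0. \<forall>e>0. \<forall>\<^sub>F g in nhds g0. \<forall>n. norm (\<alpha> g (\<phi> f n) - \<alpha> g0 (\<phi> f n)) \<le> e)
        \<and> (\<forall>a. (\<lambda>n. \<phi> f n * a - a * \<phi> f n) \<longlonglongrightarrow> 0)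
        \<and> (\<forall>g. (\<lambda>n. \<phi> (\<lambda>h. f (- g + h)) n - \<alpha> g (\<phi> f n)) \<longlonglongrightarrow> 0)
        \<and> (\<lambda>n. \<phi> (\<lambda>h. cnj (f h)) n - adj (\<phi> f n)) \<longlonglongrightarrow> 0
        \<and> (\<forall>c. (\<lambda>n. \<phi> (\<lambda>h. c * f h) n - cscale c (\<phi> f n)) \<longlonglongrightarrow> 0)"
    "\<forall>f f'. continuous_on UNIV f \<and> continuous_on UNIV f' \<longrightarrow>
        (\<lambda>n. \<phi> (\<lambda>h. f h + f' h) n - (\<phi> f n + \<phi> f' n)) \<longlonglongrightarrow> 0
        \<and> (\<lambda>n. \<phi> (\<lambda>h. f h * f' h) n - \<phi> f n * \<phi> f' n) \<longlonglongrightarrow> 0"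
    "(\<lambda>n. \<phi> (\<lambda>h. 1) n - 1) \<longlonglongrightarrow> 0"
  have "rokhlin_map \<alpha> \<phi>" by unfold_locales (use assms(1,2) phi in simp_all)
  then show ?thesis by (rule that)
qed

context rokhlin_map
begin

abbreviation \<psi> :: "('g \<Rightarrow> real) \<Rightarrow> nat \<Rightarrow> 'a" where
  "\<psi> q \<equiv> \<phi> (\<lambda>h. complex_of_real (q h))"

lemma bounded_psi: "continuous_on UNIV q \<Longrightarrow> bounded (range (\<psi> q))"
  by (intro phi_bounded continuous_intros)

lemma Bseq_psi: "continuous_on UNIV q \<Longrightarrow> Bseq (\<psi> q)"
  by (simp add: Bseq_eq_bounded bounded_psi)

lemma equicont_psi:
  assumes "continuous_on UNIV q" shows "equicont (\<psi> q)"
  unfolding equicont_def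
proof (intro allI uniform_limitI)
  fix g0 and e :: real assume "e > 0"
  then have half: "0 < e / 2" "e / 2 < e" by simp_all
  then have "\<forall>\<^sub>F g in nhds g0. \<forall>n. norm (\<alpha> g (\<psi> q n) - \<alpha> g0 (\<psi> q n)) \<le> e / 2"
    by (intro phi_equicontinuous continuous_intros assms)
  then show "\<forall>\<^sub>F g in nhds g0. \<forall>n\<in>UNIV. dist (\<alpha> g (\<psi> q n)) (\<alpha> g0 (\<psi> q n)) < e"
    by eventually_elim (auto simp only: dist_norm intro: le_less_trans[OF _ half(2)])
qed

lemma psi_refl: "continuous_on UNIV q \<Longrightarrow> asymp_eq (\<psi> q) (\<psi> q)"
  by (intro asymp_eq_refl Bseq_psi)

lemma psi_adj: "continuous_on UNIV q \<Longrightarrow> asymp_eq (\<psi> q) (\<lambda>n. adj (\<psi> q n))"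
  unfolding asymp_eq_def using phi_star[of "\<lambda>h. complex_of_real (q h)"] Bseq_psi[of q]
  by (simp add: Bseq_def continuous_on_of_real)

lemma psi_central: "continuous_on UNIV q \<Longrightarrow> asymp_eq (\<lambda>n. \<psi> q n * c) (\<lambda>n. c * \<psi> q n)"
  unfolding asymp_eq_def using phi_central[of "\<lambda>h. complex_of_real (q h)" c]
  by (simp add: continuous_on_of_real Bseq_mult_Bseq Bseq_psi)

lemma psi_mult:
  assumes "continuous_on UNIV q" "continuous_on UNIV r"
  shows "asymp_eq (\<psi> (\<lambda>h. q h * r h)) (\<lambda>n. \<psi> q n * \<psi> r n)"
  unfolding asymp_eq_def
  using phi_multiplicative[of "\<lambda>h. complex_of_real (q h)" "\<lambda>h. complex_of_real (r h)"]
    Bseq_psi[of "\<lambda>h. q h * r h"] assms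
  by (simp add: continuous_on_of_real Bseq_mult_Bseq Bseq_psi continuous_on_mult)

lemma psi_add:
  assumes "continuous_on UNIV q" "continuous_on UNIV r"
  shows "asymp_eq (\<psi> (\<lambda>h. q h + r h)) (\<lambda>n. \<psi> q n + \<psi> r n)"
  unfolding asymp_eq_def
  using phi_additive[of "\<lambda>h. complex_of_real (q h)" "\<lambda>h. complex_of_real (r h)"]
    Bseq_psi[of "\<lambda>h. q h + r h"] assms
  by (simp add: continuous_on_of_real Bseq_add_Bseq Bseq_psi continuous_on_add)

lemma psi_zero: "asymp_eq (\<psi> (\<lambda>h. 0)) (\<lambda>n. 0)"
  unfolding asymp_eq_def using phi_homogeneous[of "\<lambda>h. 1" 0] Bseq_psi[of "\<lambda>h. 0"] by simp

lemma psi_one: "asymp_eq (\<psi> (\<lambda>h. 1)) (\<lambda>n. 1)"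
  unfolding asymp_eq_def using phi_unital Bseq_psi[of "\<lambda>h. 1"] by simp

lemma psi_sum:
  assumes "finite J" "\<And>j. j \<in> J \<Longrightarrow> continuous_on UNIV (q j)"
  shows "asymp_eq (\<psi> (\<lambda>h. \<Sum>j\<in>J. q j h)) (\<lambda>n. \<Sum>j\<in>J. \<psi> (q j) n)"
  using assms
proof (induction J rule: finite_induct)
  case empty
  then show ?case using psi_zero by simp
next
  case (insert j J)
  have "asymp_eq (\<psi> (\<lambda>h. q j h + (\<Sum>j\<in>J. q j h))) (\<lambda>n. \<psi> (q j) n + \<psi> (\<lambda>h. \<Sum>j\<in>J. q j h) n)"
    using insert by (intro psi_add continuous_on_sum) auto
  also have "asymp_eq \<dots> (\<lambda>n. \<psi> (q j) n + (\<Sum>j\<in>J. \<psi> (q j) n))"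
    using insert by (intro asymp_eq_add psi_refl) auto
  finally show ?case using insert by simp
qed

lemma psi_translate:
  assumes "continuous_on UNIV q"
  shows "asymp_eq (\<lambda>n. \<alpha> g (\<psi> q n)) (\<psi> (\<lambda>h. q (- g + h)))"
proof (rule asymp_eq_sym)
  have "Bseq (\<lambda>n. \<alpha> g (\<psi> q n))" using Bseq_psi[OF assms] by (simp add: Bseq_def)
  then show "asymp_eq (\<psi> (\<lambda>h. q (- g + h))) (\<lambda>n. \<alpha> g (\<psi> q n))"
    unfolding asymp_eq_def
    using phi_equivariant[of "\<lambda>h. complex_of_real (q h)" g]
        Bseq_psi[OF continuous_translate[OF assms]] assms
    by (simp add: continuous_on_of_real)
qed

lemma psi_sqrt_conj:
  assumes continuous: "continuous_on UNIV q" and nonneg: "\<And>h. 0 \<le> q h"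
  shows "asymp_eq (\<lambda>n. \<psi> q n * c) (\<lambda>n. adj (\<psi> (\<lambda>h. sqrt (q h)) n) * c * \<psi> (\<lambda>h. sqrt (q h)) n)"
proof -
  let ?e = "\<lambda>h. sqrt (q h)"
  have continuous_sqrt: "continuous_on UNIV ?e" by (intro continuous_intros continuous)
  have "asymp_eq (\<lambda>n. \<psi> (\<lambda>h. ?e h * ?e h) n * c) (\<lambda>n. \<psi> ?e n * \<psi> ?e n * c)"
    by (intro asymp_eq_mult psi_mult asymp_eq_const continuous_sqrt)
  also have "asymp_eq \<dots> (\<lambda>n. adj (\<psi> ?e n) * (c * \<psi> ?e n))"
    unfolding mult.assoc by (intro asymp_eq_mult psi_adj psi_central continuous_sqrt)
  finally show ?thesis by (simp add: mult.assoc nonneg del: of_real_mult)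
qed

lemma psi_product_collect:
  assumes continuous_p: "continuous_on UNIV p" and continuous_q: "continuous_on UNIV q"
  shows "asymp_eq (\<lambda>n. x * adj (\<psi> p n) * y * \<psi> q n * z) (\<lambda>n. \<psi> (\<lambda>h. p h * q h) n * (x * y * z))"
proof -
  have "asymp_eq (\<lambda>n. x * adj (\<psi> p n) * y * \<psi> q n * z) (\<lambda>n. x * \<psi> p n * y * \<psi> q n * z)"
    by (intro asymp_eq_mult asymp_eq_const psi_refl asymp_eq_sym[OF psi_adj] continuous_p
        continuous_q)
  also have "asymp_eq \<dots> (\<lambda>n. \<psi> p n * x * y * \<psi> q n * z)"
    by (intro asymp_eq_mult asymp_eq_const psi_refl asymp_eq_sym[OF psi_central] continuous_p
        continuous_q)
  also have "(\<lambda>n. \<psi> p n * x * y * \<psi> q n * z) = (\<lambda>n. \<psi> p n * ((x * y) * \<psi> q n) * z)"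
    by (simp add: mult.assoc)
  also have "asymp_eq \<dots> (\<lambda>n. \<psi> p n * (\<psi> q n * (x * y)) * z)"
    by (intro asymp_eq_mult asymp_eq_const psi_refl asymp_eq_sym[OF psi_central] continuous_p
        continuous_q)
  also have "(\<lambda>n. \<psi> p n * (\<psi> q n * (x * y)) * z) = (\<lambda>n. \<psi> p n * \<psi> q n * (x * y * z))"
    by (simp add: mult.assoc)
  also have "asymp_eq \<dots> (\<lambda>n. \<psi> (\<lambda>h. p h * q h) n * (x * y * z))"
    by (intro asymp_eq_mult asymp_eq_const asymp_eq_sym[OF psi_mult] continuous_p continuous_q)
  finally show ?thesis .
qed

lemma psi_support_cong:
  assumes "continuous_on UNIV q" "\<And>h. q h \<noteq> 0 \<Longrightarrow> x = y"
  shows "asymp_eq (\<lambda>n. \<psi> q n * x) (\<lambda>n. \<psi> q n * y)"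
proof (cases "q = (\<lambda>h. 0)")
  case True
  have "asymp_eq (\<lambda>n. \<psi> q n * z) (\<lambda>n. 0)" for z
    using asymp_eq_mult[OF psi_zero asymp_eq_const, of z] by (simp add: True)
  from asymp_eq_trans[OF this asymp_eq_sym[OF this]] show ?thesis .
next
  case False
  then have "x = y" using assms(2) by auto
  then show ?thesis by (simp add: asymp_eq_mult psi_refl asymp_eq_const assms(1))
qed

lemma psi_refine:
  assumes continuous_q: "continuous_on UNIV q" and partition: "partition_of_unity K r"
  shows "asymp_eq (\<lambda>n. \<psi> q n * c) (\<lambda>n. \<Sum>k\<in>K. \<psi> (\<lambda>h. q h * r k h) n * c)"
proof -
  have "asymp_eq (\<psi> (\<lambda>h. \<Sum>k\<in>K. q h * r k h)) (\<lambda>n. \<Sum>k\<in>K. \<psi> (\<lambda>h. q h * r k h) n)"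
    by (intro psi_sum continuous_intros continuous_q partition_of_unityD[OF partition])
  then have "asymp_eq (\<lambda>n. \<psi> q n * c) (\<lambda>n. (\<Sum>k\<in>K. \<psi> (\<lambda>h. q h * r k h) n) * c)"
    by (intro asymp_eq_mult asymp_eq_const)
      (simp add: sum_distrib_left[symmetric] partition_of_unityD[OF partition]
          del: of_real_sum of_real_mult)
  then show ?thesis by (simp add: sum_distrib_right)
qed

lemma psi_partition_of_unity:
  assumes "partition_of_unity J q"
  shows "asymp_eq (\<lambda>n. c) (\<lambda>n. \<Sum>j\<in>J. \<psi> (q j) n * c)"
proof -
  have "asymp_eq (\<lambda>n. 1 * c) (\<lambda>n. \<psi> (\<lambda>h. 1) n * c)"
    by (intro asymp_eq_mult asymp_eq_const asymp_eq_sym[OF psi_one])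
  also have "asymp_eq \<dots> (\<lambda>n. \<Sum>j\<in>J. \<psi> (\<lambda>h. 1 * q j h) n * c)"
    by (intro psi_refine assms) simp
  finally show ?thesis by simp
qed

lemma psi_sqrt_partition_tendsto:
  assumes partition: "partition_of_unity J q"
  shows "(\<lambda>n. \<Sum>j\<in>J. adj (\<psi> (\<lambda>h. sqrt (q j h)) n) * \<psi> (\<lambda>h. sqrt (q j h)) n) \<longlonglongrightarrow> 1"
proof -
  have "asymp_eq (\<lambda>n. 1) (\<lambda>n. \<Sum>j\<in>J. \<psi> (q j) n * 1)" by (rule psi_partition_of_unity[OF partition])
  also have "asymp_eq \<dots> (\<lambda>n. \<Sum>j\<in>J. adj (\<psi> (\<lambda>h. sqrt (q j h)) n) * 1 * \<psi> (\<lambda>h. sqrt (q j h)) n)"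
    by (intro asymp_eq_sum psi_sqrt_conj partition_of_unityD[OF partition])
  finally have "asymp_eq (\<lambda>n. \<Sum>j\<in>J. adj (\<psi> (\<lambda>h. sqrt (q j h)) n) * \<psi> (\<lambda>h. sqrt (q j h)) n) (\<lambda>n. 1)"
    unfolding mult_1_right by (rule asymp_eq_sym)
  then show ?thesis by (simp add: asymp_eq_def LIM_zero_iff)
qed

text \<open>Writing \<open>q\<^sub>j\<close> as a square exhibits the sum \<open>\<Sum> \<psi>(q\<^sub>j) x\<^sub>j\<close> as a compression of a block diagonal
  matrix, so it is asymptotically no larger than its largest coefficient.\<close>
lemma eventually_op_bound_psi_sum:
  fixes x :: "'j \<Rightarrow> 'i \<Rightarrow> 'i \<Rightarrow> 'a"
  assumes partition: "partition_of_unity J q" and finite_I: "finite I" and finite_K: "finite K"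
    and C_nonneg: "0 \<le> C" and x_bound: "\<And>j h. j \<in> J \<Longrightarrow> q j h \<noteq> 0 \<Longrightarrow> op_bound I K (x j) C"
    and y_asymp: "\<And>i k. i \<in> I \<Longrightarrow> k \<in> K \<Longrightarrow>
      asymp_eq (\<lambda>n. y n i k) (\<lambda>n. \<Sum>j\<in>J. \<psi> (q j) n * x j i k)"
    and d_pos: "d > 0"
  shows "\<forall>\<^sub>F n in sequentially. op_bound I K (y n) (C + d)"
proof -
  define x' where "x' j = (if q j = (\<lambda>h. 0) then \<lambda>i k. 0 else x j)" for j
  have x'_bound: "op_bound I K (x' j) C" if "j \<in> J" for j
    using x_bound[OF that] C_nonneg by (cases "q j = (\<lambda>h. 0)") (auto simp: x'_def op_bound_0)
  define e where "e j = \<psi> (\<lambda>h. sqrt (q j h))" for j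
  define z where "z n i k = (\<Sum>j\<in>J. adj (e j n) * x' j i k * e j n)" for n i k
  have y_asymp_z: "asymp_eq (\<lambda>n. y n i k) (\<lambda>n. z n i k)" if "i \<in> I" "k \<in> K" for i k
  proof -
    note y_asymp[OF that]
    also have "asymp_eq (\<lambda>n. \<Sum>j\<in>J. \<psi> (q j) n * x j i k) (\<lambda>n. \<Sum>j\<in>J. \<psi> (q j) n * x' j i k)"
      by (intro asymp_eq_sum psi_support_cong partition_of_unityD[OF partition]) (auto simp: x'_def)
    also have "asymp_eq \<dots> (\<lambda>n. z n i k)"
      unfolding z_def e_def by (intro asymp_eq_sum psi_sqrt_conj partition_of_unityD[OF partition])
    finally show ?thesis .
  qed
  have "(\<lambda>n. C * norm (\<Sum>j\<in>J. adj (e j n) * e j n)) \<longlonglongrightarrow> C * norm (1::'a)"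
    unfolding e_def by (intro tendsto_intros psi_sqrt_partition_tendsto partition)
  then have "\<forall>\<^sub>F n in sequentially. C * norm (\<Sum>j\<in>J. adj (e j n) * e j n) < C + d / 2"
    by (rule order_tendstoD) (use d_pos in simp)
  then have "\<forall>\<^sub>F n in sequentially. op_bound I K (z n) (C + d / 2)"
  proof eventually_elim
    case (elim n)
    have "op_bound I K (z n) (C * norm (\<Sum>j\<in>J. adj (e j n) * e j n))"
      unfolding z_def
      by (rule op_bound_sum_compress[OF partition_of_unityD(1)[OF partition] finite_I finite_K
            C_nonneg x'_bound])
    then show ?case by (rule op_bound_mono) (use elim in simp)
  qed
  then have "\<forall>\<^sub>F n in sequentially. op_bound I K (y n) (C + d / 2 + d / 2)"
    by (rule eventually_op_bound_perturb[OF finite_I finite_K])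
      (use d_pos y_asymp_z in \<open>auto simp: asymp_eq_def\<close>)
  then show ?thesis by (simp add: add.assoc)
qed

end

section \<open>Gluing translates along a partition of unity\<close>

locale fine_partition = rokhlin_map \<alpha> \<phi>
  for \<alpha> :: "'g::{t2_space,group_add} \<Rightarrow> 'a::cstar_algebra \<Rightarrow> 'a" and \<phi> +
  fixes F :: "'g set" and p :: "'g \<Rightarrow> 'g \<Rightarrow> real"
    and I J :: "'i set" and v :: "'i \<Rightarrow> 'i \<Rightarrow> 'a" and d :: real
  assumes partition: "partition_of_unity F p"
    and finite_index: "finite I" "finite J"
    and nonneg: "0 \<le> d"
    and fine: "p g h \<noteq> 0 \<Longrightarrow> op_bound I J (\<lambda>i j. \<alpha> g (v i j) - \<alpha> h (v i j)) d"
begin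

lemma continuous_partition: "g \<in> F \<Longrightarrow> continuous_on UNIV (p g)"
  by (rule partition_of_unityD(2)[OF partition])

lemma fine_both:
  assumes "p s h \<noteq> 0" "p t h \<noteq> 0"
  shows "op_bound I J (\<lambda>i j. \<alpha> s (v i j) - \<alpha> t (v i j)) (2 * d)"
  using op_bound_diff[OF fine[OF assms(1)] fine[OF assms(2)]] by simp

definition glue :: "nat \<Rightarrow> 'i \<Rightarrow> 'i \<Rightarrow> 'a" where
  "glue n i j = (\<Sum>g\<in>F. \<psi> (p g) n * \<alpha> g (v i j))"

lemma glue_asymp_eq_sum: "asymp_eq (\<lambda>n. glue n i j) (\<lambda>n. \<Sum>g\<in>F. \<psi> (p g) n * \<alpha> g (v i j))"
  unfolding glue_def
  by (intro asymp_eq_sum asymp_eq_mult psi_refl asymp_eq_const continuous_partition)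

lemma equicont_glue: "equicont (\<lambda>n. glue n i j)"
  unfolding glue_def
  by (intro equicont_sum equicont_mult_const equicont_psi bounded_psi continuous_partition)

lemma eventually_op_bound_glue:
  assumes "op_bound I J v C" "e > 0"
  shows "\<forall>\<^sub>F n in sequentially. op_bound I J (glue n) (C + e)"
  by (rule eventually_op_bound_psi_sum[OF partition finite_index _ _ glue_asymp_eq_sum assms(2)])
    (intro op_bound_act assms op_bound_nonneg[OF assms(1)])+

lemma eventually_glue_near:
  assumes "almost_fixed I J v C" "e > 0"
  shows "\<forall>\<^sub>F n in sequentially. op_bound I J (\<lambda>i j. glue n i j - v i j) (C + e)"
proof -
  have v_bound: "op_bound I J (\<lambda>i j. \<alpha> g (v i j) - v i j) C" for g
    using assms(1) by (simp add: almost_fixed_def)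
  have "asymp_eq (\<lambda>n. glue n i j - v i j) (\<lambda>n. \<Sum>g\<in>F. \<psi> (p g) n * (\<alpha> g (v i j) - v i j))" for i j
    using asymp_eq_diff[OF glue_asymp_eq_sum psi_partition_of_unity[OF partition, of "v i j"]]
    by (simp add: right_diff_distrib sum_subtractf)
  then show ?thesis
    by (rule eventually_op_bound_psi_sum[OF partition finite_index op_bound_nonneg[OF v_bound] v_bound
          _ assms(2)])
qed

lemma act_glue_diff:
  "asymp_eq (\<lambda>n. \<alpha> g (glue n i j) - glue n i j)
    (\<lambda>n. \<Sum>r\<in>F \<times> F. \<psi> (\<lambda>h. p (fst r) (- g + h) * p (snd r) h) n
      * (\<alpha> (g + fst r) (v i j) - \<alpha> (snd r) (v i j)))"
proof -
  let ?q = "\<lambda>s t h. p s (- g + h) * p t h"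
  have "asymp_eq (\<lambda>n. \<alpha> g (glue n i j)) (\<lambda>n. \<Sum>s\<in>F. \<psi> (\<lambda>h. p s (- g + h)) n * \<alpha> (g + s) (v i j))"
    unfolding glue_def act_sum act_mult act_act
    by (intro asymp_eq_sum asymp_eq_mult asymp_eq_const psi_translate continuous_partition)
  also have "asymp_eq \<dots> (\<lambda>n. \<Sum>s\<in>F. \<Sum>t\<in>F. \<psi> (?q s t) n * \<alpha> (g + s) (v i j))"
    by (intro asymp_eq_sum psi_refine partition continuous_translate continuous_partition)
  finally have act_glue: "asymp_eq (\<lambda>n. \<alpha> g (glue n i j)) \<dots>" .
  note glue_asymp_eq_sum
  also have "asymp_eq (\<lambda>n. \<Sum>t\<in>F. \<psi> (p t) n * \<alpha> t (v i j))
      (\<lambda>n. \<Sum>t\<in>F. \<Sum>s\<in>F. \<psi> (\<lambda>h. p t h * p s (- g + h)) n * \<alpha> t (v i j))"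
    by (intro asymp_eq_sum psi_refine partition_of_unity_translate partition continuous_partition)
  also have "\<dots> = (\<lambda>n. \<Sum>s\<in>F. \<Sum>t\<in>F. \<psi> (?q s t) n * \<alpha> t (v i j))"
    by (subst sum.swap) (simp add: mult.commute)
  finally show ?thesis
    using asymp_eq_diff[OF act_glue]
    by (simp add: sum.cartesian_product' right_diff_distrib sum_subtractf)
qed

lemma eventually_act_glue_diff:
  assumes "e > 0"
  shows "\<forall>\<^sub>F n in sequentially. op_bound I J (\<lambda>i j. \<alpha> g (glue n i j) - glue n i j) (2 * d + e)"
proof (rule eventually_op_bound_psi_sum[OF _ finite_index _ _ act_glue_diff \<open>e > 0\<close>])
  show "partition_of_unity (F \<times> F) (\<lambda>r h. p (fst r) (- g + h) * p (snd r) h)"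
    by (intro partition_of_unity_Times partition_of_unity_translate partition)
  fix r h assume "p (fst r) (- g + h) * p (snd r) h \<noteq> 0"
  then have support: "p (fst r) (- g + h) \<noteq> 0" "p (snd r) h \<noteq> 0" by auto
  have "op_bound I J (\<lambda>i j. \<alpha> g (\<alpha> (fst r) (v i j) - \<alpha> (- g + h) (v i j))) d"
    by (rule op_bound_act[OF fine[OF support(1)]])
  then have "op_bound I J (\<lambda>i j. \<alpha> (g + fst r) (v i j) - \<alpha> h (v i j)) d"
    by (simp add: act_diff act_act add.assoc[symmetric])
  from op_bound_diff[OF this fine[OF support(2)]]
  show "op_bound I J (\<lambda>i j. \<alpha> (g + fst r) (v i j) - \<alpha> (snd r) (v i j)) (2 * d)" by simp
qed (simp add: nonneg)

lemma eventually_glue_almost_fixed: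
  assumes "e > 0"
  shows "\<forall>\<^sub>F n in sequentially. almost_fixed I J (glue n) (2 * d + e)"
  using assms eventually_almost_fixed[OF finite_index(2) equicont_glue eventually_act_glue_diff,
      of "e / 2" "e / 2"]
  by (simp add: add.assoc)

definition cross_sandwich :: "('i \<Rightarrow> 'i \<Rightarrow> 'a) \<Rightarrow> 'g \<times> 'g \<Rightarrow> 'i \<Rightarrow> 'i \<Rightarrow> 'a" where
  "cross_sandwich b r i j = (\<Sum>k\<in>I. (\<Sum>l\<in>I. adj (\<alpha> (fst r) (v l i)) * b l k) * \<alpha> (snd r) (v k j))"

lemma sandwich_glue:
  "asymp_eq (\<lambda>n. sandwich I (glue n) b i j)
    (\<lambda>n. \<Sum>r\<in>F \<times> F. \<psi> (\<lambda>h. p (fst r) h * p (snd r) h) n * cross_sandwich b r i j)"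
proof -
  define summand where "summand k l r n = adj (\<alpha> (fst r) (v l i)) * adj (\<psi> (p (fst r)) n) * b l k
    * \<psi> (p (snd r)) n * \<alpha> (snd r) (v k j)" for k l r n
  define collected where "collected k l r n = \<psi> (\<lambda>h. p (fst r) h * p (snd r) h) n
    * (adj (\<alpha> (fst r) (v l i)) * b l k * \<alpha> (snd r) (v k j))" for k l r n
  have "adj (glue n l i) * b l k * glue n k j = (\<Sum>r\<in>F \<times> F. summand k l r n)" for n k l
    unfolding glue_def adj_sum sum_distrib_right[of _ _ "b l k"] sum_product
    by (simp add: sum.cartesian_product' summand_def adj_mult mult.assoc)
  then have "sandwich I (glue n) b i j = (\<Sum>k\<in>I. \<Sum>l\<in>I. \<Sum>r\<in>F \<times> F. summand k l r n)" for n
    unfolding sandwich_def sum_distrib_right by simp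
  moreover have "asymp_eq (\<lambda>n. \<Sum>k\<in>I. \<Sum>l\<in>I. \<Sum>r\<in>F \<times> F. summand k l r n)
      (\<lambda>n. \<Sum>k\<in>I. \<Sum>l\<in>I. \<Sum>r\<in>F \<times> F. collected k l r n)"
    unfolding summand_def collected_def by (intro asymp_eq_sum psi_product_collect continuous_partition) auto
  moreover have "(\<Sum>k\<in>I. \<Sum>l\<in>I. \<Sum>r\<in>F \<times> F. collected k l r n)
      = (\<Sum>r\<in>F \<times> F. \<psi> (\<lambda>h. p (fst r) h * p (snd r) h) n * cross_sandwich b r i j)" for n
  proof -
    have "(\<Sum>k\<in>I. \<Sum>l\<in>I. \<Sum>r\<in>F \<times> F. collected k l r n) = (\<Sum>k\<in>I. \<Sum>r\<in>F \<times> F. \<Sum>l\<in>I. collected k l r n)"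
      by (intro sum.cong refl sum.swap)
    also have "\<dots> = (\<Sum>r\<in>F \<times> F. \<Sum>k\<in>I. \<Sum>l\<in>I. collected k l r n)" by (rule sum.swap)
    finally show ?thesis by (simp add: collected_def cross_sandwich_def sum_distrib_left sum_distrib_right)
  qed
  ultimately show ?thesis by simp
qed

lemma op_bound_cross_sandwich_diff:
  assumes a_fixed: "\<And>i j. a i j \<in> fixed_points \<alpha>" and b_fixed: "\<And>k l. b k l \<in> fixed_points \<alpha>"
    and v_bound: "op_bound I J v C" and b_bound: "op_bound I I b D"
    and approx: "op_bound J J (\<lambda>i j. sandwich I v b i j - a i j) E"
    and support: "p (fst r) h \<noteq> 0" "p (snd r) h \<noteq> 0"
  shows "op_bound J J (\<lambda>i j. cross_sandwich b r i j - a i j) (E + C * D * (2 * d))"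
proof -
  let ?s = "fst r" and ?t = "snd r"
  have "op_bound J J (\<lambda>i j. \<alpha> ?s (sandwich I v b i j - a i j)) E" by (rule op_bound_act[OF approx])
  moreover have "\<alpha> ?s (sandwich I v b i j - a i j) = cross_sandwich b (?s, ?s) i j - a i j" for i j
    using a_fixed b_fixed unfolding sandwich_def cross_sandwich_def
    by (simp add: act_diff act_sum act_mult act_adj fixed_points_def)
  ultimately have diagonal: "op_bound J J (\<lambda>i j. cross_sandwich b (?s, ?s) i j - a i j) E" by simp
  have "op_bound J J
      (\<lambda>i j. \<Sum>k\<in>I. (\<Sum>l\<in>I. adj (\<alpha> ?s (v l i)) * b l k) * (\<alpha> ?t (v k j) - \<alpha> ?s (v k j)))
      (C * D * (2 * d))"
    by (rule op_bound_mult[OF op_bound_mult[OF op_bound_adj[OF op_bound_act[OF v_bound]] b_bound]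
          fine_both[OF support(2,1)]])
  from op_bound_add[OF diagonal this] show ?thesis
    by (simp add: cross_sandwich_def right_diff_distrib sum_subtractf)
qed

lemma eventually_sandwich_glue:
  assumes a_fixed: "\<And>i j. a i j \<in> fixed_points \<alpha>" and b_fixed: "\<And>k l. b k l \<in> fixed_points \<alpha>"
    and v_bound: "op_bound I J v C" and b_bound: "op_bound I I b D"
    and approx: "op_bound J J (\<lambda>i j. sandwich I v b i j - a i j) E" and "e > 0"
  shows "\<forall>\<^sub>F n in sequentially.
    op_bound J J (\<lambda>i j. sandwich I (glue n) b i j - a i j) (E + C * D * (2 * d) + e)"
proof -
  let ?q = "\<lambda>r h. p (fst r) h * p (snd r) h"
  have partition_Times: "partition_of_unity (F \<times> F) ?q"
    by (intro partition_of_unity_Times partition)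
  show ?thesis
  proof (rule eventually_op_bound_psi_sum[OF partition_Times finite_index(2,2) _ _ _ \<open>e > 0\<close>])
    show "0 \<le> E + C * D * (2 * d)"
      using op_bound_nonneg[OF approx] op_bound_nonneg[OF v_bound] op_bound_nonneg[OF b_bound]
          nonneg by simp
    show "op_bound J J (\<lambda>i j. cross_sandwich b r i j - a i j) (E + C * D * (2 * d))"
        if "?q r h \<noteq> 0" for r h
      by (rule op_bound_cross_sandwich_diff[OF a_fixed b_fixed v_bound b_bound approx, of r h])
        (use that in auto)
    show "asymp_eq (\<lambda>n. sandwich I (glue n) b i j - a i j)
        (\<lambda>n. \<Sum>r\<in>F \<times> F. \<psi> (?q r) n * (cross_sandwich b r i j - a i j))" for i j
      using asymp_eq_diff[OF sandwich_glue psi_partition_of_unity[OF partition_Times, of "a i j"]]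
      by (simp add: right_diff_distrib sum_subtractf)
  qed
qed

end

section \<open>Passage to fixed points\<close>

lemma convergent_of_geometric_steps:
  fixes x :: "nat \<Rightarrow> 'a::banach"
  assumes "\<And>k. norm (x (Suc k) - x k) \<le> C * (1/2) ^ k"
  shows "convergent x"
proof -
  have "summable (\<lambda>k. x (Suc k) - x k)"
    by (rule summable_comparison_test'[of "\<lambda>k. C * (1/2) ^ k" 0])
      (simp_all add: assms summable_mult summable_geometric)
  then have "convergent (\<lambda>n. x n - x 0)"
    by (simp add: summable_iff_convergent sum_lessThan_telescope)
  then show ?thesis by (simp add: convergent_diff_const_right_iff)
qed

context rokhlin_map
begin

lemma fine_partition_exists:
  fixes v :: "'i \<Rightarrow> 'i \<Rightarrow> 'a"
  assumes finite_I: "finite I" and finite_J: "finite J" and d_pos: "d > 0"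
  obtains F p where "fine_partition \<alpha> \<phi> F p I J v d"
proof -
  define r where "r g h = (\<Sum>i\<in>I. \<Sum>j\<in>J. norm (\<alpha> g (v i j) - \<alpha> h (v i j)))" for g h
  have "continuous_on UNIV (r g)" for g
    unfolding r_def by (intro continuous_intros continuous_act)
  moreover have "r g g < d" for g using d_pos by (simp add: r_def)
  ultimately obtain F p where F_partition: "partition_of_unity F p" "\<And>g h. p g h \<noteq> 0 \<Longrightarrow> r g h < d"
    using partition_of_unity_exists[OF compact_UNIV, of r d] by blast
  have "op_bound I J (\<lambda>i j. \<alpha> g (v i j) - \<alpha> h (v i j)) d" if "p g h \<noteq> 0" for g h
    using op_bound_mono[OF op_bound_sum_norm[OF finite_J]
        less_imp_le[OF F_partition(2)[OF that, unfolded r_def]]] .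
  then have "fine_partition \<alpha> \<phi> F p I J v d"
    using F_partition(1) finite_I finite_J d_pos by unfold_locales auto
  then show ?thesis by (rule that)
qed

lemma almost_fixed_refine:
  fixes w :: "'i \<Rightarrow> 'i \<Rightarrow> 'a"
  assumes finite_I: "finite I" and finite_J: "finite J"
    and w_fixed: "almost_fixed I J w C" and e_pos: "e > 0"
  obtains w' where "almost_fixed I J w' e" "op_bound I J (\<lambda>i j. w' i j - w i j) (C + e)"
proof -
  obtain F p where "fine_partition \<alpha> \<phi> F p I J w (e / 4)"
    using fine_partition_exists[OF finite_I finite_J, of "e / 4"] e_pos by auto
  then interpret fine_partition \<alpha> \<phi> F p I J w "e / 4" .
  have "\<forall>\<^sub>F n in sequentially. almost_fixed I J (glue n) e
      \<and> op_bound I J (\<lambda>i j. glue n i j - w i j) (C + e)"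
    using e_pos
      eventually_conj[OF eventually_glue_almost_fixed eventually_glue_near[OF w_fixed e_pos], of "e / 2"]
    by simp
  then show ?thesis using that eventually_happens'[OF sequentially_bot] by blast
qed

lemma almost_fixed_sequence_exists:
  fixes w :: "'i \<Rightarrow> 'i \<Rightarrow> 'a"
  assumes finite_I: "finite I" and finite_J: "finite J"
    and w_fixed: "almost_fixed I J w C" and C_pos: "C > 0"
  obtains f where "f 0 = w" "\<And>k. almost_fixed I J (f k) (C * (1/2) ^ k)"
    "\<And>k. op_bound I J (\<lambda>i j. f (Suc k) i j - f k i j) (2 * (C * (1/2) ^ k))"
proof -
  define c where "c k = C * (1/2) ^ k" for k :: nat
  have c_pos: "c k > 0" and c_Suc: "c (Suc k) = c k / 2" for k using C_pos by (simp_all add: c_def)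
  have "\<exists>f. \<forall>k. (almost_fixed I J (f k) (c k) \<and> (k = 0 \<longrightarrow> f k = w))
      \<and> op_bound I J (\<lambda>i j. f (Suc k) i j - f k i j) (2 * c k)"
  proof (rule dependent_nat_choice)
    show "\<exists>y. almost_fixed I J y (c 0) \<and> (0 = (0::nat) \<longrightarrow> y = w)" using w_fixed by (simp add: c_def)
    fix y k assume "almost_fixed I J y (c k) \<and> (k = 0 \<longrightarrow> y = w)"
    then obtain y' where y'_fixed: "almost_fixed I J y' (c (Suc k))"
        and y'_near: "op_bound I J (\<lambda>i j. y' i j - y i j) (c k + c (Suc k))"
      using almost_fixed_refine[OF finite_I finite_J _ c_pos[of "Suc k"], of y "c k"] by blast
    have "c k + c (Suc k) \<le> 2 * c k" using c_pos[of k] by (simp add: c_Suc)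
    from y'_fixed op_bound_mono[OF y'_near this]
    show "\<exists>y'. (almost_fixed I J y' (c (Suc k)) \<and> (Suc k = 0 \<longrightarrow> y' = w))
        \<and> op_bound I J (\<lambda>i j. y' i j - y i j) (2 * c k)"
      by (intro exI[of _ y']) simp
  qed
  then show ?thesis using that unfolding c_def by blast
qed

lemma fixed_matrix_near:
  fixes w :: "'i \<Rightarrow> 'i \<Rightarrow> 'a"
  assumes finite_I: "finite I" and finite_J: "finite J"
    and w_fixed: "almost_fixed I J w C" and C_pos: "C > 0"
  obtains x where "\<forall>i\<in>I. \<forall>j\<in>J. x i j \<in> fixed_points \<alpha>"
    "op_bound I J (\<lambda>i j. x i j - w i j) (4 * C)"
proof -
  obtain f where f_0: "f 0 = w" and f_fixed: "\<And>k. almost_fixed I J (f k) (C * (1/2) ^ k)"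
    and f_step: "\<And>k. op_bound I J (\<lambda>i j. f (Suc k) i j - f k i j) (2 * (C * (1/2) ^ k))"
    using almost_fixed_sequence_exists[OF assms] by blast
  define x where "x i j = lim (\<lambda>k. f k i j)" for i j
  have lim: "(\<lambda>k. f k i j) \<longlonglongrightarrow> x i j" if "i \<in> I" "j \<in> J" for i j
  proof -
    have "norm (f (Suc k) i j - f k i j) \<le> (2 * C) * (1/2) ^ k" for k
      using op_bound_entry[OF f_step finite_I finite_J that, of k] by simp
    then have "convergent (\<lambda>k. f k i j)" by (rule convergent_of_geometric_steps)
    then show ?thesis by (simp add: x_def convergent_LIMSEQ_iff)
  qed
  have near: "op_bound I J (\<lambda>i j. f n i j - w i j) (4 * C - 4 * (C * (1/2) ^ n))" for n
  proof (induction n)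
    case (Suc n)
    from op_bound_add[OF f_step[of n] Suc] show ?case by simp
  qed (simp add: f_0 op_bound_0)
  have "op_bound I J (\<lambda>i j. f n i j - w i j) (4 * C)" for n
    by (rule op_bound_mono[OF near]) (use C_pos in simp)
  then have "op_bound I J (\<lambda>i j. x i j - w i j) (4 * C)"
    by (intro op_bound_limit[OF sequentially_bot, where x = "\<lambda>n i j. f n i j - w i j"])
      (simp_all add: tendsto_diff lim)
  moreover have "\<alpha> g (x i j) = x i j" if "i \<in> I" "j \<in> J" for g i j
  proof -
    have "norm (\<alpha> g (f k i j) - f k i j) \<le> C * (1/2) ^ k" for k
      using op_bound_entry[OF _ finite_I finite_J that, of "\<lambda>i j. \<alpha> g (f k i j) - f k i j"] f_fixed
      by (simp add: almost_fixed_def)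
    from always_eventually[OF allI[OF this]] have "(\<lambda>k. \<alpha> g (f k i j) - f k i j) \<longlonglongrightarrow> 0"
      by (rule Lim_null_comparison) (intro tendsto_mult_right_zero LIMSEQ_power_zero; simp)
    moreover have "(\<lambda>k. \<alpha> g (f k i j) - f k i j) \<longlonglongrightarrow> \<alpha> g (x i j) - x i j"
      by (intro tendsto_diff bounded_linear.tendsto[OF bounded_linear_act] lim that)
    ultimately have "\<alpha> g (x i j) - x i j = 0" by (rule LIMSEQ_unique[rotated])
    then show ?thesis by simp
  qed
  then have "\<forall>i\<in>I. \<forall>j\<in>J. x i j \<in> fixed_points \<alpha>" by (simp add: fixed_points_def)
  ultimately show ?thesis using that by blast
qed

lemma almost_fixed_sandwich_exists:
  fixes v :: "'i \<Rightarrow> 'i \<Rightarrow> 'a"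
  assumes finite_I: "finite I" and finite_J: "finite J"
    and a_fixed: "\<And>i j. a i j \<in> fixed_points \<alpha>" and b_fixed: "\<And>k l. b k l \<in> fixed_points \<alpha>"
    and v_bound: "op_bound I J v C" and b_bound: "op_bound I I b D"
    and approx: "op_bound J J (\<lambda>i j. sandwich I v b i j - a i j) E" and e_pos: "e > 0"
  obtains w where "almost_fixed I J w e" "op_bound I J w (C + 1)"
    "op_bound J J (\<lambda>i j. sandwich I w b i j - a i j) (E + e)"
proof -
  have CD_nonneg: "0 \<le> C * D" using op_bound_nonneg[OF v_bound] op_bound_nonneg[OF b_bound] by simp
  obtain d where d_small: "d > 0" "(4 + 4 * (C * D)) * d \<le> e"
    using ex_pos_mult_le[of "4 + 4 * (C * D)" e] CD_nonneg e_pos by auto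
  have d_estimates: "2 * d + e / 2 \<le> e" "C * D * (2 * d) + e / 2 \<le> e"
  proof -
    have "0 \<le> C * D * d" "0 \<le> d" using CD_nonneg d_small(1) by simp_all
    then show "2 * d + e / 2 \<le> e" "C * D * (2 * d) + e / 2 \<le> e"
      using d_small(2) by (simp_all add: algebra_simps)
  qed
  obtain F p where "fine_partition \<alpha> \<phi> F p I J v d"
    using fine_partition_exists[OF finite_I finite_J d_small(1)] .
  then interpret fine_partition \<alpha> \<phi> F p I J v d .
  have "e / 2 > 0" using e_pos by simp
  then have "\<forall>\<^sub>F n in sequentially. almost_fixed I J (glue n) (2 * d + e / 2)
      \<and> op_bound I J (glue n) (C + 1)
      \<and> op_bound J J (\<lambda>i j. sandwich I (glue n) b i j - a i j) (E + C * D * (2 * d) + e / 2)"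
    by (intro eventually_conj eventually_glue_almost_fixed eventually_op_bound_glue
        eventually_sandwich_glue a_fixed b_fixed v_bound b_bound approx) simp_all
  then obtain n where glue_n: "almost_fixed I J (glue n) (2 * d + e / 2)"
      "op_bound I J (glue n) (C + 1)"
      "op_bound J J (\<lambda>i j. sandwich I (glue n) b i j - a i j) (E + C * D * (2 * d) + e / 2)"
    using eventually_happens'[OF sequentially_bot] by blast
  show ?thesis
    using almost_fixed_mono[OF glue_n(1) d_estimates(1)] glue_n(2)
      op_bound_mono[OF glue_n(3), of "E + e"] d_estimates(2)
    by (intro that[of "glue n"]) simp_all
qed

lemma fixed_sandwich_exists:
  fixes v :: "'i \<Rightarrow> 'i \<Rightarrow> 'a"
  assumes finite_I: "finite I" and finite_J: "finite J"
    and a_fixed: "\<And>i j. a i j \<in> fixed_points \<alpha>" and b_fixed: "\<And>k l. b k l \<in> fixed_points \<alpha>"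
    and approx: "op_bound J J (\<lambda>i j. sandwich I v b i j - a i j) E" and e_pos: "e > 0"
  obtains x where "\<forall>i\<in>I. \<forall>j\<in>J. x i j \<in> fixed_points \<alpha>"
    "op_bound J J (\<lambda>i j. sandwich I x b i j - a i j) (E + e)"
proof -
  obtain C where v_bound: "op_bound I J v C" using op_bound_sum_norm[OF finite_J] by blast
  obtain D where b_bound: "op_bound I I b D" using op_bound_sum_norm[OF finite_I] by blast
  have nonneg: "0 \<le> C" "0 \<le> D" using op_bound_nonneg v_bound b_bound by blast+
  have "0 \<le> 4 + 8 * D * (2 * C + 3)" using nonneg by simp
  then obtain d where d_small: "d > 0" "(4 + 8 * D * (2 * C + 3)) * d \<le> min 1 e"
    using ex_pos_mult_le[of "4 + 8 * D * (2 * C + 3)" "min 1 e"] e_pos by auto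
  have "0 \<le> D * (2 * C + 3) * d" using nonneg d_small(1) by simp
  then have d_estimates: "4 * d \<le> 1" "8 * (D * (2 * C + 3) * d) \<le> e" "d \<le> e / 4"
    using d_small by (simp_all add: algebra_simps)
  obtain w where w_approx: "almost_fixed I J w d" "op_bound I J w (C + 1)"
      "op_bound J J (\<lambda>i j. sandwich I w b i j - a i j) (E + d)"
    by (rule almost_fixed_sandwich_exists[OF finite_I finite_J a_fixed b_fixed v_bound b_bound
        approx d_small(1)])
  obtain x where x_approx: "\<forall>i\<in>I. \<forall>j\<in>J. x i j \<in> fixed_points \<alpha>"
      "op_bound I J (\<lambda>i j. x i j - w i j) (4 * d)"
    by (rule fixed_matrix_near[OF finite_I finite_J w_approx(1) d_small(1)])
  have "op_bound I J x (4 * d + (C + 1))" using op_bound_add[OF x_approx(2) w_approx(2)] by simp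
  then have "op_bound I J x (C + 2)" by (rule op_bound_mono) (use d_estimates in simp)
  from op_bound_add[OF op_bound_sandwich_diff[OF this w_approx(2) b_bound x_approx(2)] w_approx(3)]
  have "op_bound J J (\<lambda>i j. sandwich I x b i j - a i j)
      (4 * d * D * (C + 2) + (C + 1) * D * (4 * d) + (E + d))" by simp
  moreover have "4 * d * D * (C + 2) + (C + 1) * D * (4 * d) + (E + d) \<le> E + e"
    using d_estimates(2,3) e_pos by (simp add: algebra_simps)
  ultimately show ?thesis using that x_approx(1) op_bound_mono by blast
qed

lemma cuntz_approx_fixed:
  assumes a_stab: "a \<in> stab (fixed_points \<alpha>)" and b_stab: "b \<in> stab (fixed_points \<alpha>)"
    and v_stab: "v \<in> stab UNIV" and approx: "mat_bound (\<lambda>i j. mconj v b i j - a i j) E"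
    and e_pos: "e > 0"
  obtains w where "w \<in> stab (fixed_points \<alpha>)" "mat_bound (\<lambda>i j. mconj w b i j - a i j) (E + e)"
proof -
  obtain D where b_bound: "mat_bound b D" using stab_bounded[OF b_stab] .
  have "e / 3 > 0" using e_pos by simp
  then obtain N where
    v_trunc: "mat_bound (\<lambda>i j. mconj (trunc N v) b i j - mconj v b i j) (e / 3)" and
    a_trunc: "mat_bound (\<lambda>i j. a i j - trunc N a i j) (e / 3)"
    using eventually_happens'[OF sequentially_bot
        eventually_conj[OF eventually_mconj_trunc_near[OF v_stab b_bound] stab_tail[OF a_stab]]]
    by blast
  have fixed: "a i j \<in> fixed_points \<alpha>" "b i j \<in> fixed_points \<alpha>" for i j
    using a_stab b_stab by (simp_all add: stab_iff)
  have "op_bound {..<N} {..<N} (\<lambda>i j. mconj (trunc N v) b i j - a i j) (e / 3 + E)"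
    using mat_boundD[OF mat_bound_add[OF v_trunc approx]] by simp
  then have "op_bound {..<N} {..<N} (\<lambda>i j. sandwich {..<N} v b i j - a i j) (e / 3 + E)"
    by (rule op_bound_cong[THEN iffD1, rotated]) (simp add: mconj_trunc, simp add: trunc_def)
  then obtain x where x_approx: "\<forall>i\<in>{..<N}. \<forall>j\<in>{..<N}. x i j \<in> fixed_points \<alpha>"
      "op_bound {..<N} {..<N} (\<lambda>i j. sandwich {..<N} x b i j - a i j) (e / 3 + E + e / 3)"
    by (rule fixed_sandwich_exists[OF finite_lessThan finite_lessThan fixed _ \<open>e / 3 > 0\<close>])
  have "mat_bound
      (\<lambda>i j. trunc N (\<lambda>i j. sandwich {..<N} x b i j - a i j) i j - (a i j - trunc N a i j))
      (e / 3 + E + e / 3 + e / 3)"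
    by (rule mat_bound_diff[OF mat_bound_trunc[OF x_approx(2)] a_trunc])
  moreover have "trunc N (\<lambda>i j. sandwich {..<N} x b i j - a i j) i j - (a i j - trunc N a i j)
      = mconj (trunc N x) b i j - a i j" for i j
    unfolding mconj_trunc by (simp add: trunc_def)
  ultimately have "mat_bound (\<lambda>i j. mconj (trunc N x) b i j - a i j) (E + e)"
    by (simp add: algebra_simps)
  moreover have "trunc N x \<in> stab (fixed_points \<alpha>)"
    by (rule trunc_in_stab) (use x_approx(1) in \<open>auto simp: fixed_points_def\<close>)
  ultimately show ?thesis using that by blast
qed

end

theorem theorem3p16:
  fixes \<alpha> :: "'g::{t2_space, second_countable_topology, group_add} \<Rightarrow> 'a::cstar_algebra \<Rightarrow> 'a"
    and a b :: "'a mat"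
  assumes "separable_type TYPE('a)"
    and "compact_group TYPE('g)"
    and "cstar_action \<alpha>"
    and "rokhlin \<alpha>"
    and "a \<in> cu_pos (fixed_points \<alpha>)" and "b \<in> cu_pos (fixed_points \<alpha>)"
    and "cuntz_le UNIV a b"
  shows "cuntz_le (fixed_points \<alpha>) a b"
proof -
  obtain \<phi> where "rokhlin_map \<alpha> \<phi>" using rokhlin_map_exists[OF assms(2-4)] .
  then interpret rokhlin_map \<alpha> \<phi> .
  have stab: "a \<in> stab (fixed_points \<alpha>)" "b \<in> stab (fixed_points \<alpha>)"
    using assms(5,6) cu_pos_fixed_points_subset_stab by blast+
  obtain A D where bounded: "mat_bound a A" "mat_bound b D" using stab stab_bounded by metis
  show ?thesis
    unfolding cuntz_le_iff[OF bounded]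
  proof (intro allI impI)
    fix e :: real assume "e > 0"
    then have "e / 2 > 0" by simp
    then obtain v where "v \<in> stab UNIV" "mat_bound (\<lambda>i j. mconj v b i j - a i j) (e / 2)"
      using assms(7) unfolding cuntz_le_iff[OF bounded] by blast
    from cuntz_approx_fixed[OF stab this \<open>e / 2 > 0\<close>]
    show "\<exists>w\<in>stab (fixed_points \<alpha>). mat_bound (\<lambda>i j. mconj w b i j - a i j) e" by auto
  qed
qed

end
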